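(* For any intermediate logic $\mathsf L$ the following are equivalent: (i) $\mathsf L$ has hereditary projective approximation; (ii) $\mathsf L(\mathbf H_{pa})\subseteq\mathsf L$; (iii) $\mathsf L$ omits $\mathfrak G_3$ and $\mathfrak R_2$; (iv) $\chi(\mathfrak G_3)\in\mathsf L$ and $\chi(\mathfrak R_2)\in\mathsf L$.
   Context: An intermediate logic is a set of intuitionistic propositional formulas containing $\mathsf{INT}$, closed under modus ponens and substitution. A frame is a finite poset with a least element; $\mathsf L(\mathbf F)$ is the set of formulas valid in all Kripke models over frames of the class $\mathbf F$; $\mathsf L$ omits a frame $\mathfrak F$ if $\mathsf L\not\subseteq\mathsf L(\mathfrak F)$. For a finite rooted frame $\mathfrak F$, $\chi(\mathfrak F)$ is Jankov's characteristic formula, which satisfies: for every intermediate logic $\mathsf L$, $\chi(\mathfrak F)\in\mathsf L$ iff $\mathsf L$ omits $\mathfrak F$. Frames: $\mathfrak L_d$ the $d$-element chain; $\mathfrak F_n$ ($n\ge2$) a root with $n$ incomparable maximal elements, $\mathfrak F_0=\mathfrak L_1$, $\mathfrak F_1=\mathfrak L_2$; $\mathfrak R_2$ is $\mathfrak F_2$ with a top added; $\mathfrak G_3$ has elements $r,a,b,c$ with $r<a$, $r<b<c$ (and transitivity) and no other relations. For disjoint frames $\mathfrak F=(W,\le_W,w_0)$, $\mathfrak G=(U,\le_U,u_0)$, $\mathfrak F+\mathfrak G$ is $W\cup U$ rooted at $w_0$ with $x\le y$ iff $x\le_W y$ or $x\le_U y$ or ($x\in W$, $y\in U$). $\mathbf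 H_{pa}=\{\mathfrak L_d+\mathfrak F_m: d,m\ge0\}$ with $\mathfrak L_0+\mathfrak F_m=\mathfrak F_m$. Projective approximation: for every formula $A$ there is a finite set $\Pi(A)$ of formulas $B$, each having a projective $\mathsf L$-unifier (a substitution $\varepsilon$ with $\varepsilon(B)\in\mathsf L$ and $B\vdash_{\mathsf L}\varepsilon(x)\leftrightarrow x$ for all variables $x$), with $\mathrm{Var}(B)\subseteq\mathrm{Var}(A)$ and $B\vdash_{\mathsf L}A$, such that every $\mathsf L$-unifier of $A$ unifies some $B\in\Pi(A)$. $\mathsf L$ has hereditary projective approximation if every intermediate logic $\mathsf L'\supseteq\mathsf L$ (including $\mathsf L$) has projective approximation. *)

theory Defs
  imports Main "HOL-Library.Nat_Bijection"
begin

section \<open>Formulas and intermediate logics\<close>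

datatype fm = Var nat | Bot | And fm fm | Or fm fm | Imp fm fm

definition Iff :: "fm \<Rightarrow> fm \<Rightarrow> fm" where
  "Iff A B = And (Imp A B) (Imp B A)"

primrec vars :: "fm \<Rightarrow> nat set" where
  "vars (Var x) = {x}"
| "vars Bot = {}"
| "vars (And A B) = vars A \<union> vars B"
| "vars (Or A B) = vars A \<union> vars B"
| "vars (Imp A B) = vars A \<union> vars B"

primrec subst :: "(nat \<Rightarrow> fm) \<Rightarrow> fm \<Rightarrow> fm" where
  "subst \<epsilon> (Var x) = \<epsilon> x"
| "subst \<epsilon> Bot = Bot"
| "subst \<epsilon> (And A B) = And (subst \<epsilon> A) (subst \<epsilon> B)"
| "subst \<epsilon> (Or A B) = Or (subst \<epsilon> A) (subst \<epsilon> B)"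
| "subst \<epsilon> (Imp A B) = Imp (subst \<epsilon> A) (subst \<epsilon> B)"

inductive_set INT_logic :: "fm set" where
  K: "Imp A (Imp B A) \<in> INT_logic"
| S: "Imp (Imp A (Imp B C)) (Imp (Imp A B) (Imp A C)) \<in> INT_logic"
| AndE1: "Imp (And A B) A \<in> INT_logic"
| AndE2: "Imp (And A B) B \<in> INT_logic"
| AndI: "Imp A (Imp B (And A B)) \<in> INT_logic"
| OrI1: "Imp A (Or A B) \<in> INT_logic"
| OrI2: "Imp B (Or A B) \<in> INT_logic"
| OrE: "Imp (Imp A C) (Imp (Imp B C) (Imp (Or A B) C)) \<in> INT_logic"
| BotE: "Imp Bot A \<in> INT_logic"
| MP: "A \<in> INT_logic \<Longrightarrow> Imp A B \<in> INT_logic \<Longrightarrow> B \<in> INT_logic"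

text \<open>Consistency is not required: the set of all formulas is an intermediate logic.\<close>

definition intermediate_logic :: "fm set \<Rightarrow> bool" where
  "intermediate_logic L \<longleftrightarrow>
     INT_logic \<subseteq> L \<and>
     (\<forall>A B. A \<in> L \<longrightarrow> Imp A B \<in> L \<longrightarrow> B \<in> L) \<and>
     (\<forall>\<epsilon> A. A \<in> L \<longrightarrow> subst \<epsilon> A \<in> L)"

text \<open>The consequence relation of \<open>L\<close>: modus ponens is applied to members of \<open>L\<close> and
  to the premises, but substitution is not applied to the premises.\<close>

inductive derives :: "fm set \<Rightarrow> fm set \<Rightarrow> fm \<Rightarrow> bool" for L X where
  logic: "A \<in> L \<Longrightarrow> derives L X A"
| premise: "A \<in> X \<Longrightarrow> derives L X A"
| mp: "derives L X A \<Longrightarrow> derives L X (Imp A B) \<Longrightarrow> derives L X B"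


section \<open>Projective approximation\<close>

definition unifier :: "fm set \<Rightarrow> (nat \<Rightarrow> fm) \<Rightarrow> fm \<Rightarrow> bool" where
  "unifier L \<epsilon> A \<longleftrightarrow> subst \<epsilon> A \<in> L"

definition projective_unifier :: "fm set \<Rightarrow> (nat \<Rightarrow> fm) \<Rightarrow> fm \<Rightarrow> bool" where
  "projective_unifier L \<epsilon> B \<longleftrightarrow>
     unifier L \<epsilon> B \<and> (\<forall>x. derives L {B} (Iff (\<epsilon> x) (Var x)))"

definition projective_approximation :: "fm set \<Rightarrow> bool" where
  "projective_approximation L \<longleftrightarrow>
     (\<forall>A. \<exists>\<Pi>. finite \<Pi> \<and>
        (\<forall>B\<in>\<Pi>. (\<exists>\<epsilon>. projective_unifier L \<epsilon> B) \<and> vars B \<subseteq> vars A \<and> derives L {B} A) \<and>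
        (\<forall>\<epsilon>. unifier L \<epsilon> A \<longrightarrow> (\<exists>B\<in>\<Pi>. unifier L \<epsilon> B)))"

definition hereditary_projective_approximation :: "fm set \<Rightarrow> bool" where
  "hereditary_projective_approximation L \<longleftrightarrow>
     (\<forall>L'. intermediate_logic L' \<longrightarrow> L \<subseteq> L' \<longrightarrow> projective_approximation L')"


section \<open>Kripke semantics\<close>

text \<open>A frame is given by its (reflexive) order relation \<open>r\<close>; its set of worlds is
  \<open>Field r\<close>.\<close>

definition is_root :: "'w rel \<Rightarrow> 'w \<Rightarrow> bool" where
  "is_root r w \<longleftrightarrow> w \<in> Field r \<and> (\<forall>x\<in>Field r. (w, x) \<in> r)"

definition is_frame :: "'w rel \<Rightarrow> bool" where
  "is_frame r \<longleftrightarrow> finite (Field r) \<and> Partial_order r \<and> (\<exists>w. is_root r w)"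

definition upsets :: "'w rel \<Rightarrow> 'w set set" where
  "upsets r = {U. U \<subseteq> Field r \<and> (\<forall>x y. x \<in> U \<longrightarrow> (x, y) \<in> r \<longrightarrow> y \<in> U)}"

primrec forces :: "'w rel \<Rightarrow> (nat \<Rightarrow> 'w set) \<Rightarrow> 'w \<Rightarrow> fm \<Rightarrow> bool" where
  "forces r V w (Var x) \<longleftrightarrow> w \<in> V x"
| "forces r V w Bot \<longleftrightarrow> False"
| "forces r V w (And A B) \<longleftrightarrow> forces r V w A \<and> forces r V w B"
| "forces r V w (Or A B) \<longleftrightarrow> forces r V w A \<or> forces r V w B"
| "forces r V w (Imp A B) \<longleftrightarrow> (\<forall>u. (w, u) \<in> r \<longrightarrow> forces r V u A \<longrightarrow> forces r V u B)"

definition logic_of :: "'w rel set \<Rightarrow> fm set" where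
  "logic_of \<F> =
     {A. \<forall>r\<in>\<F>. \<forall>V. (\<forall>x. V x \<in> upsets r) \<longrightarrow> (\<forall>w\<in>Field r. forces r V w A)}"

definition omits :: "fm set \<Rightarrow> 'w rel \<Rightarrow> bool" where
  "omits L r \<longleftrightarrow> \<not> L \<subseteq> logic_of {r}"


section \<open>The frames\<close>

definition chain_frame :: "nat \<Rightarrow> nat rel" where
  "chain_frame d = {(i, j). i \<le> j \<and> j < d}"

text \<open>Root \<open>0\<close> and maximal elements \<open>1, \<dots>, n\<close>; this yields the one- and the two-element
  chain for \<open>n = 0\<close> and \<open>n = 1\<close>.\<close>

definition fork_frame :: "nat \<Rightarrow> nat rel" where
  "fork_frame n = {(i, j). i \<le> n \<and> j \<le> n \<and> (i = j \<or> i = 0)}"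

text \<open>Meant for relations with disjoint fields.\<close>

definition frame_sum :: "'w rel \<Rightarrow> 'w rel \<Rightarrow> 'w rel" where
  "frame_sum r s = r \<union> s \<union> Field r \<times> Field s"

definition R2 :: "nat rel" where
  "R2 = frame_sum (fork_frame 2) {(3, 3)}"

text \<open>\<open>r, a, b, c\<close> are encoded as \<open>0, 1, 2, 3\<close>.\<close>

definition G3 :: "nat rel" where
  "G3 = Id_on {0, 1, 2, 3} \<union> {(0, 1), (0, 2), (0, 3), (2, 3)}"

text \<open>The fork is shifted by \<open>d\<close> to make it disjoint from the chain. As
  \<open>chain_frame 0\<close> is empty, the member for \<open>d = 0\<close> is \<open>fork_frame m\<close> itself.\<close>

definition H_pa :: "nat rel set" where
  "H_pa = {frame_sum (chain_frame d) (dir_image (fork_frame m) (\<lambda>i. d + i)) | d m. True}"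


section \<open>Jankov's characteristic formula\<close>

text \<open>The up-sets of a finite rooted frame form a finite subdirectly irreducible Heyting
  algebra, whose second largest element is the set of all worlds but the root.
  Jankov's formula says that the diagram of this algebra implies the variable of that
  element. The variable of an up-set \<open>U\<close> of a frame on \<open>nat\<close> is the one indexed
  by \<open>set_encode U\<close>.\<close>

definition frame_root :: "'w rel \<Rightarrow> 'w" where
  "frame_root r = (THE w. is_root r w)"

definition upset_imp :: "'w rel \<Rightarrow> 'w set \<Rightarrow> 'w set \<Rightarrow> 'w set" where
  "upset_imp r U V = {w \<in> Field r. \<forall>u. (w, u) \<in> r \<longrightarrow> u \<in> U \<longrightarrow> u \<in> V}"

definition upset_var :: "nat set \<Rightarrow> fm" where
  "upset_var U = Var (set_encode U)"

definition upset_list :: "nat rel \<Rightarrow> nat set list" where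
  "upset_list r = map set_decode (sorted_list_of_set (set_encode ` upsets r))"

definition Conjunction :: "fm list \<Rightarrow> fm" where
  "Conjunction As = foldr And As (Imp Bot Bot)"

definition diagram :: "nat rel \<Rightarrow> fm list" where
  "diagram r =
     Iff (upset_var {}) Bot #
     concat [[Iff (upset_var (U \<inter> V)) (And (upset_var U) (upset_var V)),
              Iff (upset_var (U \<union> V)) (Or (upset_var U) (upset_var V)),
              Iff (upset_var (upset_imp r U V)) (Imp (upset_var U) (upset_var V))].
             U \<leftarrow> upset_list r, V \<leftarrow> upset_list r]"

definition jankov :: "nat rel \<Rightarrow> fm" where
  "jankov r = Imp (Conjunction (diagram r)) (upset_var (Field r - {frame_root r}))"


section \<open>Sanity checks\<close>

lemma Field_chain: "Field (chain_frame d) = {..<d}"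
  by (auto simp: Field_def chain_frame_def)

lemma Field_fork: "Field (fork_frame n) = {..n}"
  by (auto simp: Field_def fork_frame_def)

lemma Field_frame_sum: "Field (frame_sum r s) = Field r \<union> Field s"
  by (fastforce simp: Field_def frame_sum_def)

lemma Field_shift: "Field (dir_image (fork_frame m) (\<lambda>i. d + i)) = {d..d + m}"
  unfolding dir_image_Field Field_fork
  by (simp add: atMost_atLeast0)

lemma fork_0: "fork_frame 0 = chain_frame 1" and fork_1: "fork_frame 1 = chain_frame 2"
  by (auto simp: fork_frame_def chain_frame_def)

lemma frame_sum_chain_0:
  "frame_sum (chain_frame 0) (dir_image (fork_frame m) (\<lambda>i. 0 + i)) = fork_frame m"
  by (auto simp: frame_sum_def chain_frame_def dir_image_def)

lemma is_frame_fork: "is_frame (fork_frame n)"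
proof -
  have "is_root (fork_frame n) 0"
    unfolding is_root_def Field_fork by (auto simp: fork_frame_def)
  moreover have "Partial_order (fork_frame n)"
    unfolding partial_order_on_def preorder_on_def refl_on_def trans_def antisym_def Field_fork
    by (auto simp: fork_frame_def)
  ultimately show ?thesis
    by (auto simp: is_frame_def Field_fork)
qed

lemma is_frame_chain: "d > 0 \<Longrightarrow> is_frame (chain_frame d)"
proof -
  assume "d > 0"
  then have "is_root (chain_frame d) 0"
    unfolding is_root_def Field_chain by (auto simp: chain_frame_def)
  moreover have "Partial_order (chain_frame d)"
    unfolding partial_order_on_def preorder_on_def refl_on_def trans_def antisym_def Field_chain
    by (auto simp: chain_frame_def)
  ultimately show ?thesis
    by (auto simp: is_frame_def Field_chain)
qed

lemma is_frame_frame_sum: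
  assumes "is_frame r" "is_frame s" "Field r \<inter> Field s = {}"
  shows "is_frame (frame_sum r s)"
proof -
  have dj: "x \<in> Field s \<Longrightarrow> x \<notin> Field r" for x
    using assms(3) by auto
  have F: "x \<in> Field q" "y \<in> Field q" if "(x, y) \<in> q" for x y and q :: "'a rel"
    using that by (auto simp: Field_def)
  have "\<exists>w. is_root (frame_sum r s) w"
    using assms(1) unfolding is_frame_def is_root_def Field_frame_sum
    by (auto simp: frame_sum_def)
  moreover have "Refl (frame_sum r s)"
    using assms(1,2) unfolding refl_on_def Field_frame_sum is_frame_def
      partial_order_on_def preorder_on_def by (auto simp: frame_sum_def)
  moreover have "trans (frame_sum r s)"
    using assms(1,2) dj F unfolding is_frame_def partial_order_on_def preorder_on_def
    by (auto simp: frame_sum_def intro!: transI dest: transD; metis transD)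
  moreover have "antisym (frame_sum r s)"
    using assms(1,2) dj F unfolding is_frame_def partial_order_on_def
    by (auto simp: frame_sum_def intro!: antisymI dest: antisymD; metis antisymD)
  ultimately show ?thesis
    using assms(1,2) unfolding is_frame_def partial_order_on_def preorder_on_def
    by (auto simp: Field_frame_sum dest: FieldI1 FieldI2)
qed

lemma is_frame_R2: "is_frame R2"
  unfolding R2_def
  by (rule is_frame_frame_sum[OF is_frame_fork])
     (auto simp: is_frame_def is_root_def Field_fork partial_order_on_def preorder_on_def
        refl_on_def trans_def antisym_def Field_def fork_frame_def)

lemma is_frame_G3: "is_frame G3"
proof -
  have F: "Field G3 = {0, 1, 2, 3}"
    by (auto simp: Field_def G3_def)
  have "is_root G3 0"
    unfolding is_root_def F by (auto simp: G3_def)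
  moreover have "Partial_order G3"
    unfolding partial_order_on_def preorder_on_def refl_on_def trans_def antisym_def F
    by (auto simp: G3_def)
  ultimately show ?thesis
    by (auto simp: is_frame_def F)
qed

lemma is_frame_H_pa: "r \<in> H_pa \<Longrightarrow> is_frame r"
proof -
  assume "r \<in> H_pa"
  then obtain d m where r: "r = frame_sum (chain_frame d) (dir_image (fork_frame m) (\<lambda>i. d + i))"
    by (auto simp: H_pa_def)
  have "is_root (dir_image (fork_frame m) (\<lambda>i. d + i)) d"
    unfolding is_root_def Field_shift by (auto simp: dir_image_def fork_frame_def) presburger
  moreover have "Partial_order (dir_image (fork_frame m) (\<lambda>i. d + i))"
    unfolding partial_order_on_def preorder_on_def refl_on_def trans_def antisym_def Field_shift
    by (auto simp: dir_image_def fork_frame_def) presburger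
  ultimately have s: "is_frame (dir_image (fork_frame m) (\<lambda>i. d + i))"
    by (auto simp: is_frame_def Field_shift)
  show "is_frame r"
  proof (cases "d = 0")
    case True
    then show ?thesis
      using r frame_sum_chain_0 is_frame_fork by simp
  next
    case False
    then show ?thesis
      unfolding r by (intro is_frame_frame_sum is_frame_chain s) (auto simp: Field_chain Field_shift)
  qed
qed

lemma set_upset_list:
  assumes "finite (Field r)"
  shows "set (upset_list r) = upsets r"
proof -
  have fin: "finite U" if "U \<in> upsets r" for U
    using that assms by (auto simp: upsets_def intro: finite_subset)
  have "finite (upsets r)"
    by (rule finite_subset[of _ "Pow (Field r)"]) (auto simp: upsets_def assms)
  then show ?thesis
    by (force simp: upset_list_def image_image fin cong: image_cong)
qed

lemma root_eq: "is_frame r \<Longrightarrow> is_root r w \<Longrightarrow> frame_root r = w"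
  unfolding frame_root_def
  by (rule the_equality)
     (auto simp: is_frame_def is_root_def partial_order_on_def dest: antisymD)

end

(* The four conditions meet in one axiom, here called fork_axiom: of two incomparable worlds above a
   common one, both are maximal. It is canonical, and the logic of H_pa is axiomatised by it.
   If L omits G3 and R2, definable p-morphisms give Scott's rule and the linearity of p and q whenever
   not not (p <-> q); these two yield the axiom. Conversely G3 and R2 refute it, and their logics have
   no projective approximation. Given the axiom, one approximates A by adding to it the negations of
   the classical types on Var(A) that a unifier excludes; there are finitely many such formulas, and
   each is projective because a fork over unified types can always be filled in by the unifier. *)
theory Submission
  imports Defs
begin

text \<open>The frame of prime theories of an arbitrary logic need not validate that logic. Omission
  of a finite frame is therefore exploited only through maps onto it under which the preimages of
  up-sets are given by formulas, since such maps become substitutions. The axiom makes up for this: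
  three formulas witness its failure, so it transfers to the worlds themselves. After that,
  comparability of worlds is all that is used, and projectivity needs no finite models of the
  extensions. The excluded types have to be recorded because \<open>A\<close> alone need not be
  projective: \<open>Or (Var 0) (Neg (Var 0))\<close> may have only unifiers that decide the
  variable, so no value can be found at a root below both types. A single unifier realises every
  type that it does not exclude; a further substitution can then steer it to any of these types,
  independently at each maximal world.\<close>

abbreviation Neg :: "fm \<Rightarrow> fm" where
  "Neg A \<equiv> Imp A Bot"


section \<open>The canonical model\<close>

text \<open>These are the consistent prime theories containing \<open>L\<close>. If \<open>L\<close>
  consists of all formulas there are none, so the inconsistent logic needs no separate
  treatment.\<close>

definition world :: "fm set \<Rightarrow> fm set \<Rightarrow> bool" where
  "world L T \<longleftrightarrow> L \<subseteq> T \<and> (\<forall>A B. A \<in> T \<longrightarrow> Imp A B \<in> T \<longrightarrow> B \<in> T) \<and> Bot \<notin> T \<and>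
     (\<forall>A B. Or A B \<in> T \<longrightarrow> A \<in> T \<or> B \<in> T)"

definition maximal_world :: "fm set \<Rightarrow> fm set \<Rightarrow> bool" where
  "maximal_world L T \<longleftrightarrow> world L T \<and> (\<forall>T'. world L T' \<longrightarrow> T \<subseteq> T' \<longrightarrow> T' = T)"

lemma derives_mono: "derives L X A \<Longrightarrow> X \<subseteq> Y \<Longrightarrow> derives L Y A"
  by (induction rule: derives.induct) (auto intro: derives.intros)

lemma derives_Union_chain:
  assumes "derives L (\<Union>C) A" "C \<noteq> {}" "\<forall>X\<in>C. \<forall>Y\<in>C. X \<subseteq> Y \<or> Y \<subseteq> X"
  shows "\<exists>X\<in>C. derives L X A"
  using assms(1)
proof (induction rule: derives.induct)
  case (logic A)
  then show ?case using assms(2) by (auto intro: derives.logic)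
next
  case (premise A)
  then show ?case by (auto intro: derives.premise)
next
  case (mp A B)
  then obtain X Y where "X \<in> C" "derives L X A" "Y \<in> C" "derives L Y (Imp A B)" by blast
  then show ?case
    using assms(3) by (meson derives.mp derives_mono)
qed

locale intermediate =
  fixes L :: "fm set"
  assumes intermediate_logic: "intermediate_logic L"
begin

lemma INT_subset: "A \<in> INT_logic \<Longrightarrow> A \<in> L"
  and mp_closed: "A \<in> L \<Longrightarrow> Imp A B \<in> L \<Longrightarrow> B \<in> L"
  and subst_closed: "A \<in> L \<Longrightarrow> subst \<epsilon> A \<in> L"
  using intermediate_logic unfolding intermediate_logic_def by blast+

lemma derives_INT: "A \<in> INT_logic \<Longrightarrow> derives L X A"
  by (simp add: INT_subset derives.logic)

lemma deduction: "derives L (insert A X) B \<Longrightarrow> derives L X (Imp A B)"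
proof (induction rule: derives.induct)
  case (logic B)
  then show ?case by (meson INT_logic.K derives.logic derives.mp derives_INT)
next
  case (premise B)
  then show ?case
    by (metis INT_logic.K INT_logic.S derives.mp derives.premise derives_INT insertE)
next
  case (mp B C)
  then show ?case by (meson INT_logic.S derives.mp derives_INT)
qed

lemma cut: "derives L X A \<Longrightarrow> derives L (insert A X) C \<Longrightarrow> derives L X C"
  using deduction derives.mp by blast

lemma derives_empty: "derives L {} A \<Longrightarrow> A \<in> L"
  by (induction rule: derives.induct) (auto intro: mp_closed)

text \<open>Zorn's lemma is applied to the sets that do not derive \<open>C\<close>. The last
  property is exported because for \<open>C = Bot\<close> it says that the world is maximal.\<close>

lemma Lindenbaum:
  assumes "\<not> derives L X C"
  obtains T where "X \<subseteq> T" "world L T" "C \<notin> T" "\<And>A. A \<notin> T \<Longrightarrow> derives L (insert A T) C"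
proof -
  let ?S = "{T. X \<subseteq> T \<and> \<not> derives L T C}"
  have "\<exists>T\<in>?S. \<forall>Y\<in>?S. T \<subseteq> Y \<longrightarrow> Y = T"
  proof (rule subset_Zorn_nonempty)
    show "?S \<noteq> {}" using assms by blast
    fix \<C> assume c: "\<C> \<noteq> {}" "subset.chain ?S \<C>"
    then show "\<Union>\<C> \<in> ?S"
      using derives_Union_chain[of L \<C> C] by (fastforce simp: subset_chain_def)
  qed
  then obtain T where T: "T \<in> ?S" and m: "\<And>Y. Y \<in> ?S \<Longrightarrow> T \<subseteq> Y \<Longrightarrow> Y = T"
    by meson
  have ext: "derives L (insert A T) C" if "A \<notin> T" for A
  proof (rule ccontr)
    assume "\<not> ?thesis"
    then have "insert A T = T" using m[of "insert A T"] T by blast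
    then show False using that by blast
  qed
  have closed: "A \<in> T" if "derives L T A" for A
    using that cut[OF that ext] T by auto
  have "A \<in> T \<or> B \<in> T" if "Or A B \<in> T" for A B
  proof (rule ccontr)
    assume "\<not> ?thesis"
    then have "derives L T (Imp A C)" "derives L T (Imp B C)"
      using ext deduction by auto
    then have "derives L T C"
      using derives.mp[OF derives.premise[OF that]] by (meson INT_logic.OrE derives.mp derives_INT)
    then show False using T by blast
  qed
  moreover have "Bot \<notin> T"
    using T by (simp, meson INT_logic.BotE derives.mp derives.premise derives_INT)
  ultimately have "world L T"
    unfolding world_def using closed by (blast intro: derives.intros)
  then show thesis
    using that[of T] T ext by (auto intro: derives.premise)
qed

lemma derives_world:
  assumes "derives L X A" "world L T" "X \<subseteq> T" shows "A \<in> T"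
  using assms(1) by induction (use assms(2,3) in \<open>unfold world_def, blast+\<close>)

lemma derives_if_worlds:
  "(\<And>T. world L T \<Longrightarrow> X \<subseteq> T \<Longrightarrow> A \<in> T) \<Longrightarrow> derives L X A"
  using Lindenbaum by blast

lemma mem_if_worlds: "(\<And>T. world L T \<Longrightarrow> A \<in> T) \<Longrightarrow> A \<in> L"
  by (simp add: derives_empty derives_if_worlds)

lemma mem_world: "world L T \<Longrightarrow> A \<in> L \<Longrightarrow> A \<in> T"
  unfolding world_def by blast

lemma world_Bot [simp]: "world L T \<Longrightarrow> Bot \<notin> T"
  unfolding world_def by blast

lemma world_mp: "world L T \<Longrightarrow> A \<in> T \<Longrightarrow> Imp A B \<in> T \<Longrightarrow> B \<in> T"
  unfolding world_def by blast

lemma world_INT: "world L T \<Longrightarrow> A \<in> INT_logic \<Longrightarrow> A \<in> T"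
  by (simp add: INT_subset mem_world)

lemma world_And [simp]:
  assumes "world L T" shows "And A B \<in> T \<longleftrightarrow> A \<in> T \<and> B \<in> T"
  using world_mp[OF assms _ world_INT[OF assms INT_logic.AndE1]]
    world_mp[OF assms _ world_INT[OF assms INT_logic.AndE2]]
    world_mp[OF assms _ world_mp[OF assms _ world_INT[OF assms INT_logic.AndI]]] by blast

lemma world_Or [simp]:
  assumes "world L T" shows "Or A B \<in> T \<longleftrightarrow> A \<in> T \<or> B \<in> T"
  using world_mp[OF assms _ world_INT[OF assms INT_logic.OrI1]]
    world_mp[OF assms _ world_INT[OF assms INT_logic.OrI2]]
    assms unfolding world_def by blast

text \<open>This is the truth lemma: membership behaves as forcing in the Kripke model of all worlds
  ordered by inclusion.\<close>

lemma world_Imp: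
  assumes "world L T"
  shows "Imp A B \<in> T \<longleftrightarrow> (\<forall>T'. world L T' \<longrightarrow> T \<subseteq> T' \<longrightarrow> A \<in> T' \<longrightarrow> B \<in> T')"
proof
  assume "Imp A B \<in> T"
  then show "\<forall>T'. world L T' \<longrightarrow> T \<subseteq> T' \<longrightarrow> A \<in> T' \<longrightarrow> B \<in> T'"
    using world_mp by blast
next
  assume *: "\<forall>T'. world L T' \<longrightarrow> T \<subseteq> T' \<longrightarrow> A \<in> T' \<longrightarrow> B \<in> T'"
  have "derives L T (Imp A B)"
    by (intro deduction derives_if_worlds) (use * in auto)
  then show "Imp A B \<in> T"
    using derives_world[OF _ assms] by blast
qed

lemma world_Neg:
  "world L T \<Longrightarrow> Neg A \<in> T \<longleftrightarrow> (\<forall>T'. world L T' \<longrightarrow> T \<subseteq> T' \<longrightarrow> A \<notin> T')"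
  by (auto simp: world_Imp)

lemma world_Neg_Neg:
  assumes "world L T"
  shows "Neg (Neg A) \<in> T \<longleftrightarrow>
    (\<forall>T'. world L T' \<longrightarrow> T \<subseteq> T' \<longrightarrow> (\<exists>T''. world L T'' \<and> T' \<subseteq> T'' \<and> A \<in> T''))"
  using assms by (subst world_Neg) (auto simp: world_Neg)

lemma maximal_world_extends:
  assumes "world L T"
  obtains M where "maximal_world L M" "T \<subseteq> M"
proof -
  have "\<not> derives L T Bot"
    using derives_world[OF _ assms subset_refl, of Bot] world_Bot[OF assms] by blast
  then obtain M where M: "T \<subseteq> M" "world L M" "\<And>A. A \<notin> M \<Longrightarrow> derives L (insert A M) Bot"
    using Lindenbaum by metis
  have "M' = M" if M': "world L M'" "M \<subseteq> M'" for M'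
  proof (rule ccontr)
    assume "M' \<noteq> M"
    then obtain A where "A \<in> M'" "A \<notin> M" using M' by blast
    then show False
      using derives_world[OF M(3) M'(1)] M' world_Bot by blast
  qed
  then show thesis
    using that M by (auto simp: maximal_world_def)
qed

lemma maximal_Imp: "maximal_world L T \<Longrightarrow> Imp A B \<in> T \<longleftrightarrow> (A \<in> T \<longrightarrow> B \<in> T)"
  using world_Imp[of T A B] by (auto simp: maximal_world_def)

text \<open>Agreement is asked only above \<open>w\<close>, since the projective unifier coincides
  with a known one only in certain cones.\<close>

lemma subst_cong_worlds:
  assumes "\<And>x u. x \<in> vars C \<Longrightarrow> world L u \<Longrightarrow> w \<subseteq> u \<Longrightarrow> \<sigma> x \<in> u \<longleftrightarrow> \<tau> x \<in> u"
    and "world L u" "w \<subseteq> u"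
  shows "subst \<sigma> C \<in> u \<longleftrightarrow> subst \<tau> C \<in> u"
  using assms
proof (induction C arbitrary: u)
  case (Imp C D)
  have "subst \<sigma> C \<in> u' \<longleftrightarrow> subst \<tau> C \<in> u'" "subst \<sigma> D \<in> u' \<longleftrightarrow> subst \<tau> D \<in> u'"
    if "world L u'" "u \<subseteq> u'" for u'
    using Imp.IH(1)[OF Imp.prems(1), of u'] Imp.IH(2)[OF Imp.prems(1), of u'] Imp.prems(3) that by auto
  then show ?case
    using Imp.prems(2) by (simp add: world_Imp cong: imp_cong)
qed auto

end


section \<open>Kripke semantics of finite frames\<close>

lemma is_frameD:
  assumes "is_frame r"
  shows "trans r" "w \<in> Field r \<Longrightarrow> (w, w) \<in> r" "antisym r" "finite (Field r)"
  using assms by (auto simp: is_frame_def partial_order_on_def preorder_on_def refl_on_def)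

lemma forces_mono:
  assumes "trans r" "\<And>x. V x \<in> upsets r" "forces r V w A" "(w, u) \<in> r"
  shows "forces r V u A"
  using assms(3,4)
proof (induction A arbitrary: w u)
  case (Var x)
  then show ?case using assms(2)[of x] unfolding upsets_def by auto
next
  case (Imp A B)
  then show ?case using assms(1) by (auto dest: transD)
qed auto

lemma forces_subst:
  assumes "w \<in> Field r"
  shows "forces r V w (subst \<sigma> A) \<longleftrightarrow> forces r (\<lambda>x. {u \<in> Field r. forces r V u (\<sigma> x)}) w A"
  using assms by (induction A arbitrary: w) (auto dest: FieldI2)

lemma forced_upset:
  assumes "trans r" "\<And>x. V x \<in> upsets r"
  shows "{u \<in> Field r. forces r V u A} \<in> upsets r"
  using forces_mono[OF assms] by (auto simp: upsets_def dest: FieldI2)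

lemma intermediate_logic_of_frame:
  assumes "is_frame r"
  shows "intermediate_logic (logic_of {r})"
  unfolding intermediate_logic_def
proof (intro conjI allI impI subsetI)
  note r = is_frameD[OF assms]
  have refl: "(y, y) \<in> r" and tr: "(y, z) \<in> r \<Longrightarrow> (x, z) \<in> r" if "(x, y) \<in> r" for x y z
    using that r by (auto dest: FieldI2 transD)
  have mp: "B \<in> logic_of {r}" if "A \<in> logic_of {r}" "Imp A B \<in> logic_of {r}" for A B
    using that r(2) by (simp add: logic_of_def)
  then show "B \<in> logic_of {r}" if "A \<in> logic_of {r}" "Imp A B \<in> logic_of {r}" for A B
    using that by blast
  show "subst \<epsilon> A \<in> logic_of {r}" if "A \<in> logic_of {r}" for \<epsilon> A
    using that forced_upset[OF r(1)] by (simp add: logic_of_def forces_subst)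
  fix A assume "A \<in> INT_logic"
  then show "A \<in> logic_of {r}"
  proof induction
    case (K A B)
    then show ?case
      using forces_mono[OF r(1)] by (auto simp: logic_of_def)
  next
    case (S A B C)
    then show ?case
      using refl tr unfolding logic_of_def by simp meson
  next
    case (AndI A B)
    then show ?case
      using forces_mono[OF r(1)] by (auto simp: logic_of_def)
  next
    case (OrE A C B)
    then show ?case
      using refl tr by (simp add: logic_of_def)
  next
    case (MP A B)
    then show ?case using mp by blast
  qed (auto simp: logic_of_def)
qed

lemma derives_forces:
  assumes "derives (logic_of {r}) {B} A" "is_frame r" "\<And>x. V x \<in> upsets r" "w \<in> Field r"
    "forces r V w B"
  shows "forces r V w A"
  using assms(1)
proof induction
  case (mp A B)
  then show ?case using is_frameD(2)[OF assms(2,4)] by auto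
qed (use assms in \<open>auto simp: logic_of_def\<close>)

lemma Field_G3: "Field G3 = {0, 1, 2, 3}"
  by (auto simp: Field_def G3_def)

lemma R2_eq: "R2 = Id_on {0, 1, 2, 3} \<union> {(0, 1), (0, 2), (0, 3), (1, 3), (2, 3)}"
proof -
  have "Field {(3::nat, 3)} = {3}" by (auto simp: Field_def)
  then show ?thesis
    unfolding R2_def frame_sum_def Field_fork by (auto simp: fork_frame_def Id_on_iff)
qed

lemma Field_R2: "Field R2 = {0, 1, 2, 3}"
  by (auto simp: Field_def R2_eq)

lemma is_root_G3: "is_root G3 0"
  unfolding is_root_def Field_G3 by (auto simp: G3_def)

lemma is_root_R2: "is_root R2 0"
  unfolding is_root_def Field_R2 by (auto simp: R2_eq)

lemma all_above_G3:
  "(\<forall>u. (0, u) \<in> G3 \<longrightarrow> P u) \<longleftrightarrow> P 0 \<and> P 1 \<and> P 2 \<and> P 3"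
  "(\<forall>u. (Suc 0, u) \<in> G3 \<longrightarrow> P u) \<longleftrightarrow> P 1"
  "(\<forall>u. (2, u) \<in> G3 \<longrightarrow> P u) \<longleftrightarrow> P 2 \<and> P 3"
  "(\<forall>u. (3, u) \<in> G3 \<longrightarrow> P u) \<longleftrightarrow> P 3"
  by (auto simp: G3_def)

lemma all_above_R2:
  "(\<forall>u. (0, u) \<in> R2 \<longrightarrow> P u) \<longleftrightarrow> P 0 \<and> P 1 \<and> P 2 \<and> P 3"
  "(\<forall>u. (Suc 0, u) \<in> R2 \<longrightarrow> P u) \<longleftrightarrow> P 1 \<and> P 3"
  "(\<forall>u. (2, u) \<in> R2 \<longrightarrow> P u) \<longleftrightarrow> P 2 \<and> P 3"
  "(\<forall>u. (3, u) \<in> R2 \<longrightarrow> P u) \<longleftrightarrow> P 3"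
  by (auto simp: R2_eq)

lemma ex_above_G3:
  "(\<exists>u. (0, u) \<in> G3 \<and> P u) \<longleftrightarrow> P 0 \<or> P 1 \<or> P 2 \<or> P 3"
  "(\<exists>u. (Suc 0, u) \<in> G3 \<and> P u) \<longleftrightarrow> P 1"
  "(\<exists>u. (2, u) \<in> G3 \<and> P u) \<longleftrightarrow> P 2 \<or> P 3"
  "(\<exists>u. (3, u) \<in> G3 \<and> P u) \<longleftrightarrow> P 3"
  by (auto simp: G3_def)

lemma ex_above_R2:
  "(\<exists>u. (0, u) \<in> R2 \<and> P u) \<longleftrightarrow> P 0 \<or> P 1 \<or> P 2 \<or> P 3"
  "(\<exists>u. (Suc 0, u) \<in> R2 \<and> P u) \<longleftrightarrow> P 1 \<or> P 3"
  "(\<exists>u. (2, u) \<in> R2 \<and> P u) \<longleftrightarrow> P 2 \<or> P 3"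
  "(\<exists>u. (3, u) \<in> R2 \<and> P u) \<longleftrightarrow> P 3"
  by (auto simp: R2_eq)

lemma upsets_G3: "U \<in> upsets G3 \<longleftrightarrow> U \<subseteq> {0, 1, 2, 3} \<and> (0 \<in> U \<longrightarrow> 1 \<in> U \<and> 2 \<in> U) \<and> (2 \<in> U \<longrightarrow> 3 \<in> U)"
  unfolding upsets_def Field_G3 by (auto simp: G3_def)

lemma upsets_R2: "U \<in> upsets R2 \<longleftrightarrow> U \<subseteq> {0, 1, 2, 3} \<and> (0 \<in> U \<longrightarrow> 1 \<in> U \<and> 2 \<in> U) \<and>
    (1 \<in> U \<longrightarrow> 3 \<in> U) \<and> (2 \<in> U \<longrightarrow> 3 \<in> U)"
  unfolding upsets_def Field_R2 by (auto simp: R2_eq)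


section \<open>Omitting a frame\<close>

context intermediate
begin

text \<open>A valuation on \<open>F\<close> pulls back along \<open>f\<close> to sets defined by
  formulas. Substituting these formulas into a member of \<open>L\<close> yields a member of
  \<open>L\<close>, hence of \<open>x\<close>, and the p-morphism conditions carry its truth from
  \<open>x\<close> to the root of \<open>F\<close>.\<close>

lemma not_omits_if_p_morphism:
  fixes f :: "fm set \<Rightarrow> 'w"
  assumes F: "is_frame F" and x: "world L x" and root: "is_root F (f x)"
    and forth: "\<And>v u. world L v \<Longrightarrow> x \<subseteq> v \<Longrightarrow> world L u \<Longrightarrow> v \<subseteq> u \<Longrightarrow> (f v, f u) \<in> F"
    and lift: "\<And>v k. world L v \<Longrightarrow> x \<subseteq> v \<Longrightarrow> (f v, k) \<in> F \<Longrightarrow> \<exists>u. world L u \<and> v \<subseteq> u \<and> f u = k"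
    and definable: "\<And>U. U \<in> upsets F \<Longrightarrow> \<exists>C. \<forall>v. world L v \<longrightarrow> x \<subseteq> v \<longrightarrow> (C \<in> v \<longleftrightarrow> f v \<in> U)"
  shows "\<not> omits L F"
proof -
  obtain \<phi> where \<phi>: "\<And>U v. U \<in> upsets F \<Longrightarrow> world L v \<Longrightarrow> x \<subseteq> v \<Longrightarrow> \<phi> U \<in> v \<longleftrightarrow> f v \<in> U"
    using definable by metis
  have "forces F V w A" if A: "A \<in> L" and V: "\<And>y. V y \<in> upsets F" and w: "w \<in> Field F" for A V w
  proof -
    let ?\<sigma> = "\<lambda>y. \<phi> (V y)"
    have "subst ?\<sigma> C \<in> v \<longleftrightarrow> forces F V (f v) C" if "world L v" "x \<subseteq> v" for C v
      using that
    proof (induction C arbitrary: v)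
      case (Imp C D)
      have "forces F V (f v) (Imp C D) \<longleftrightarrow>
          (\<forall>u. world L u \<longrightarrow> v \<subseteq> u \<longrightarrow> forces F V (f u) C \<longrightarrow> forces F V (f u) D)"
        using forth[OF Imp.prems] lift[OF Imp.prems] by (simp, metis)
      also have "\<dots> \<longleftrightarrow> subst ?\<sigma> (Imp C D) \<in> v"
        using Imp by (simp add: world_Imp)
      finally show ?case by simp
    qed (use \<phi> V in auto)
    then have "forces F V (f x) A"
      using x mem_world subst_closed[OF A] by blast
    then show ?thesis
      using forces_mono[OF is_frameD(1)[OF F] V] root w by (auto simp: is_root_def)
  qed
  then show ?thesis
    by (auto simp: omits_def logic_of_def)
qed

section \<open>Rules obtained from omitting \<open>G3\<close> and from omitting
  \<open>R2\<close>\<close>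

lemma world_Neg_NegI: "world L v \<Longrightarrow> A \<in> v \<Longrightarrow> Neg (Neg A) \<in> v"
  by (auto simp: world_Neg_Neg)

lemma world_Neg_NegD: "world L v \<Longrightarrow> Neg (Neg A) \<in> v \<Longrightarrow> Neg A \<notin> v"
  using world_mp[of v "Neg A" Bot] by auto

lemma world_Imp_refute:
  assumes "world L v" "Imp A B \<notin> v"
  obtains u where "world L u" "v \<subseteq> u" "A \<in> u" "B \<notin> u"
  using assms world_Imp by blast

text \<open>If the conclusion fails at \<open>y\<close>, sorting the worlds above \<open>y\<close>
  by which of \<open>u\<close>, \<open>Neg (Neg u)\<close> and \<open>Neg u\<close> they contain is
  a definable p-morphism onto \<open>G3\<close>.\<close>

lemma omits_G3_Scott:
  assumes "omits L G3" "world L y" "Imp (Imp (Neg (Neg u)) u) (Or u (Neg u)) \<in> y"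
  shows "Neg u \<in> y \<or> Neg (Neg u) \<in> y"
proof (rule ccontr)
  assume *: "\<not> ?thesis"
  define f :: "fm set \<Rightarrow> nat" where
    "f v = (if u \<in> v then 3 else if Neg (Neg u) \<in> v then 2 else if Neg u \<in> v then 1 else 0)" for v
  have NN: "Neg (Neg u) \<in> v" "Neg u \<notin> v" if "world L v" "u \<in> v" for v
    using that world_Neg_NegI world_mp[of v u Bot] by auto
  have "\<not> omits L G3"
  proof (rule not_omits_if_p_morphism[OF is_frame_G3 assms(2)])
    show "is_root G3 (f y)"
      using * NN[OF assms(2)] is_root_G3 by (auto simp: f_def)
    fix v assume v: "world L v" "y \<subseteq> v"
    show "(f v, f w) \<in> G3" if "world L w" "v \<subseteq> w" for w
      using that NN[OF v(1)] NN[OF that(1)] world_Neg_NegD[OF v(1), of u] world_Neg_NegD[OF that(1), of u]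
      by (auto simp: f_def G3_def)
    fix k assume k: "(f v, k) \<in> G3"
    show "\<exists>w. world L w \<and> v \<subseteq> w \<and> f w = k"
    proof (cases "f v = k")
      case True
      then show ?thesis using v by blast
    next
      case False
      then have c: "f v = 2 \<and> k = 3 \<or> f v = 0 \<and> (k = 1 \<or> k = 2 \<or> k = 3)"
        using k by (auto simp: G3_def)
      then have nn: "Neg u \<notin> v"
        using world_Neg_NegD[OF v(1), of u] by (auto simp: f_def split: if_splits)
      show ?thesis
      proof (cases "k = 3")
        case True
        then show ?thesis using nn v(1) by (auto simp: f_def world_Neg)
      next
        case k3: False
        then have f0: "u \<notin> v" "Neg (Neg u) \<notin> v" "k = 1 \<or> k = 2"
          using c by (auto simp: f_def split: if_splits)
        show ?thesis
        proof (cases "k = 1")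
          case True
          obtain w where w: "world L w" "v \<subseteq> w" "Neg u \<in> w"
            using world_Imp_refute[OF v(1) f0(2)] by blast
          then have "f w = k"
            using True NN(2)[OF w(1)] world_Neg_NegD[OF w(1)] by (auto simp: f_def)
          then show ?thesis using w by blast
        next
          case False
          \<comment> \<open>The premise of Scott's rule is what makes a world of value 0 see one of
            value 2.\<close>
          have "Imp (Neg (Neg u)) u \<notin> v"
            using world_mp[OF v(1) _ subsetD[OF v(2) assms(3)]] f0 nn world_Or[OF v(1)] by blast
          then obtain w where w: "world L w" "v \<subseteq> w" "Neg (Neg u) \<in> w" "u \<notin> w"
            using world_Imp_refute[OF v(1)] by blast
          then have "f w = k"
            using False f0 by (simp add: f_def)
          then show ?thesis using w by blast
        qed
      qed
    qed
  next
    fix U assume U: "U \<in> upsets G3"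
    \<comment> \<open>The formula of an up-set is the disjunction of the formulas of the principal
      up-sets of its members; for the root this is a tautology.\<close>
    let ?C = "if 0 \<in> U then Imp Bot Bot else Or (if 1 \<in> U then Neg u else Bot)
      (Or (if 2 \<in> U then Neg (Neg u) else Bot) (if 3 \<in> U then u else Bot))"
    have "?C \<in> v \<longleftrightarrow> f v \<in> U" if v: "world L v" for v
      using U NN[OF v] world_Neg_NegD[OF v, of u] v by (auto simp: f_def upsets_G3 world_Imp[OF v, of Bot Bot])
    then show "\<exists>C. \<forall>v. world L v \<longrightarrow> y \<subseteq> v \<longrightarrow> (C \<in> v \<longleftrightarrow> f v \<in> U)" by blast
  qed
  then show False using assms(1) by blast
qed

text \<open>If the conclusion fails at \<open>y\<close>, sorting the worlds above \<open>y\<close>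
  by which of the two implications they contain is a definable p-morphism onto
  \<open>R2\<close>.\<close>

lemma omits_R2_linear:
  assumes "omits L R2" "world L y" "Neg (Neg (And (Imp p q) (Imp q p))) \<in> y"
  shows "Imp p q \<in> y \<or> Imp q p \<in> y"
proof (rule ccontr)
  assume *: "\<not> ?thesis"
  define f :: "fm set \<Rightarrow> nat" where
    "f v = (if Imp p q \<in> v then if Imp q p \<in> v then 3 else 1 else if Imp q p \<in> v then 2 else 0)" for v
  have "\<not> omits L R2"
  proof (rule not_omits_if_p_morphism[OF is_frame_R2 assms(2)])
    show "is_root R2 (f y)"
      using * is_root_R2 by (auto simp: f_def)
    fix v assume v: "world L v" "y \<subseteq> v"
    show "(f v, f w) \<in> R2" if "world L w" "v \<subseteq> w" for w
      using that by (auto simp: f_def R2_eq)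
    fix k assume k: "(f v, k) \<in> R2"
    \<comment> \<open>A world refuting \<open>Imp b a\<close> in the strict sense, with
      \<open>b\<close> but without \<open>a\<close>, contains the opposite implication for
      free.\<close>
    have one_sided: "\<exists>w. world L w \<and> v \<subseteq> w \<and> Imp a b \<in> w \<and> Imp b a \<notin> w" if ba: "Imp b a \<notin> v" for a b
    proof -
      obtain w where w: "world L w" "v \<subseteq> w" "b \<in> w" "a \<notin> w"
        using world_Imp_refute[OF v(1) ba] by blast
      have "Imp a b \<in> w" using w by (auto simp: world_Imp)
      moreover have "Imp b a \<notin> w" using world_mp[OF w(1,3)] w(4) by blast
      ultimately show ?thesis using w by blast
    qed
    have "k = f v \<or> k = 3 \<or> f v = 0 \<and> (k = 1 \<or> k = 2)"
      using k by (auto simp: R2_eq)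
    \<comment> \<open>The double negation in the hypothesis supplies the top of \<open>R2\<close>
      above every world.\<close>
    moreover have "\<exists>w. world L w \<and> v \<subseteq> w \<and> f w = 3"
    proof -
      obtain w where w: "world L w" "v \<subseteq> w" "And (Imp p q) (Imp q p) \<in> w"
        using assms(3) v unfolding world_Neg_Neg[OF assms(2)] by blast
      then have "f w = 3" by (simp add: f_def)
      then show ?thesis using w by blast
    qed
    moreover have "\<exists>w. world L w \<and> v \<subseteq> w \<and> f w = 1" "\<exists>w. world L w \<and> v \<subseteq> w \<and> f w = 2"
      if "f v = 0"
      using one_sided[of q p] one_sided[of p q] that by (auto simp: f_def split: if_splits)
    ultimately show "\<exists>w. world L w \<and> v \<subseteq> w \<and> f w = k"
      using v by blast
  next
    fix U assume U: "U \<in> upsets R2"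
    let ?C = "if 0 \<in> U then Imp Bot Bot else Or (if 1 \<in> U then Imp p q else Bot)
      (Or (if 2 \<in> U then Imp q p else Bot) (if 3 \<in> U then And (Imp p q) (Imp q p) else Bot))"
    have "?C \<in> v \<longleftrightarrow> f v \<in> U" if v: "world L v" for v
      using U v by (auto simp: f_def upsets_R2 world_Imp[OF v, of Bot Bot])
    then show "\<exists>C. \<forall>v. world L v \<longrightarrow> y \<subseteq> v \<longrightarrow> (C \<in> v \<longleftrightarrow> f v \<in> U)" by blast
  qed
  then show False using assms(1) by blast
qed

end

text \<open>If \<open>p\<close> and \<open>q\<close> separate two worlds above a common one, the
  world with \<open>p\<close> must decide every \<open>s\<close>, so it is maximal. Exchanging the
  two worlds gives the same for the other.\<close>

definition fork_axiom :: "fm \<Rightarrow> fm \<Rightarrow> fm \<Rightarrow> fm" where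
  "fork_axiom p q s = Or (Imp p (Or q (Or s (Neg s)))) (Imp q p)"

section \<open>From the two rules to the axiom on incomparable worlds\<close>

context intermediate
begin

text \<open>Maximal worlds are classical, so double negations can be checked by truth tables
  there.\<close>

lemma Neg_Neg_if_maximal:
  assumes "world L v" "\<And>m. maximal_world L m \<Longrightarrow> v \<subseteq> m \<Longrightarrow> A \<in> m"
  shows "Neg (Neg A) \<in> v"
  unfolding world_Neg_Neg[OF assms(1)]
proof (intro allI impI)
  fix u assume "world L u" "v \<subseteq> u"
  moreover then obtain m where "maximal_world L m" "u \<subseteq> m"
    using maximal_world_extends by blast
  ultimately show "\<exists>m. world L m \<and> u \<subseteq> m \<and> A \<in> m"
    using assms(2) by (meson maximal_world_def subset_trans)
qed

lemma maximal_worldD: "maximal_world L m \<Longrightarrow> world L m"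
  by (simp add: maximal_world_def)

text \<open>Both \<open>?p\<close> and \<open>?q\<close> are classical tautologies, hence densely
  equivalent, and linearity compares them. If \<open>?p\<close> implies \<open>?q\<close>, it even
  implies \<open>Or s (Neg s)\<close>, and Scott's rule applies. If \<open>?q\<close> implies
  \<open>?p\<close>, then \<open>Neg (Neg s)\<close> implies \<open>?p\<close> and thereby
  \<open>s\<close>.\<close>

lemma omits_Neg_Neg_cases:
  assumes "omits L G3" "omits L R2" and x: "world L x"
  shows "Imp (Neg (Neg s)) s \<in> x \<or> Neg (Neg s) \<in> x"
proof -
  let ?p = "Imp (Neg (Neg s)) s" and ?q = "Or (Neg (Neg s)) (Neg s)"
  have "Neg (Neg (And (Imp ?p ?q) (Imp ?q ?p))) \<in> x"
    by (rule Neg_Neg_if_maximal[OF x]) (auto simp: maximal_worldD maximal_Imp)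
  then consider "Imp ?p ?q \<in> x" | "Imp ?q ?p \<in> x"
    using omits_R2_linear[OF assms(2) x] by blast
  then show ?thesis
  proof cases
    case 1
    have "Or s (Neg s) \<in> v" if v: "world L v" "x \<subseteq> v" "?p \<in> v" for v
      using world_mp[OF v(1,3), of ?q] world_mp[OF v(1) _ v(3)] 1 v by auto
    then have "Imp ?p (Or s (Neg s)) \<in> x"
      by (subst world_Imp[OF x]) blast
    then have "Neg s \<in> x \<or> Neg (Neg s) \<in> x"
      by (rule omits_G3_Scott[OF assms(1) x])
    moreover have "?p \<in> x" if "Neg s \<in> x"
      using that world_Neg_NegD by (subst world_Imp[OF x]) blast
    ultimately show ?thesis by blast
  next
    case 2
    have "s \<in> v" if v: "world L v" "x \<subseteq> v" "Neg (Neg s) \<in> v" for v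
      using world_mp[OF v(1) _ world_mp[OF v(1) _ subsetD[OF v(2) 2]]] v by simp
    then have "?p \<in> x"
      by (subst world_Imp[OF x]) blast
    then show ?thesis by blast
  qed
qed

text \<open>The formula \<open>?u\<close> is dense at \<open>y\<close> because excluded middle is,
  but it is missing from \<open>y\<close> because \<open>s\<close> is undecided there. So
  \<open>Imp (Neg (Neg ?u)) ?u\<close> fails at \<open>x\<close>, and only the other case of
  \<open>omits_Neg_Neg_cases\<close> remains. In terms of worlds: a non-maximal \<open>y\<close> is
  contained in every maximal world above \<open>x\<close>.\<close>

lemma omits_dense:
  assumes "omits L G3" "omits L R2" "world L x" and y: "world L y" "x \<subseteq> y"
    and "t \<in> y" "s \<notin> y" "Neg s \<notin> y"
  shows "Neg (Neg t) \<in> x"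
proof -
  let ?u = "And t (Or s (Neg s))"
  have "Neg (Neg ?u) \<in> y"
    using assms(6) by (intro Neg_Neg_if_maximal y) (auto simp: maximal_worldD maximal_Imp)
  moreover have "?u \<notin> y"
    using assms by simp
  ultimately have "Neg (Neg ?u) \<in> x"
    using omits_Neg_Neg_cases[OF assms(1-3), of ?u] world_mp[OF y(1)] y(2) by blast
  then show ?thesis
    using world_And unfolding world_Neg_Neg[OF assms(3)] by blast
qed

lemma omits_fork_axiom:
  assumes "omits L G3" "omits L R2"
  shows "fork_axiom p q s \<in> L"
proof (rule mem_if_worlds, rule ccontr)
  fix x assume x: "world L x" and "fork_axiom p q s \<notin> x"
  then have "Imp p (Or q (Or s (Neg s))) \<notin> x" "Imp q p \<notin> x"
    by (auto simp: fork_axiom_def)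
  then obtain y z where y: "world L y" "x \<subseteq> y" "p \<in> y" "Or q (Or s (Neg s)) \<notin> y"
    and z: "world L z" "x \<subseteq> z" "q \<in> z" "p \<notin> z"
    by (meson world_Imp_refute x)
  have dense: "Neg (Neg t) \<in> x" if "t \<in> y" for t
    using omits_dense[OF assms x y(1,2) that, of s] y by simp
  \<comment> \<open>Linearity cannot be applied to \<open>p\<close> and \<open>q\<close>, as
    \<open>q\<close> need not be dense at \<open>x\<close>. Its excluded middle is dense, and so is
    \<open>p\<close>, which lies in the non-maximal \<open>y\<close>.\<close>
  let ?q = "Or q (Neg q)"
  have "Neg (Neg (And (Imp p ?q) (Imp ?q p))) \<in> x"
  proof (rule Neg_Neg_if_maximal[OF x])
    fix m assume m: "maximal_world L m" "x \<subseteq> m"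
    then have "Neg (Neg p) \<in> m" using dense[OF y(3)] by blast
    then show "And (Imp p ?q) (Imp ?q p) \<in> m"
      using m by (auto simp: maximal_worldD maximal_Imp)
  qed
  then consider "Imp p ?q \<in> x" | "Imp ?q p \<in> x"
    using omits_R2_linear[OF assms(2) x] by blast
  then show False
  proof cases
    case 1
    then have "?q \<in> y" using world_mp[OF y(1,3)] y(2) by blast
    \<comment> \<open>Density now carries \<open>Neg q\<close> from \<open>y\<close> to the maximal
      worlds above \<open>z\<close>, against \<open>q\<close> in \<open>z\<close>.\<close>
    then have "Neg q \<in> y" using y(1,4) by simp
    then have "Neg (Neg (Neg q)) \<in> z" using dense z(2) by blast
    then show False
      using world_Neg_NegI[OF z(1,3)] world_Neg_NegD[OF z(1), of "Neg q"] by blast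
  next
    case 2
    then show False using world_mp[OF z(1), of ?q p] z by auto
  qed
qed

end

lemma fork_axiom_not_in_G3: "fork_axiom (Var 0) (Var 1) (Var 2) \<notin> logic_of {G3}"
proof
  assume "fork_axiom (Var 0) (Var 1) (Var 2) \<in> logic_of {G3}"
  \<comment> \<open>The worlds 2 and 1 are separated by the variables 0 and 1, and variable 2 shows
    that 2 is not maximal.\<close>
  moreover define V :: "nat \<Rightarrow> nat set" where "V x = (if x = 0 then {2, 3} else if x = 1 then {1} else {3})" for x
  moreover have "V x \<in> upsets G3" for x
    by (auto simp: V_def upsets_G3)
  ultimately have "forces G3 V 0 (fork_axiom (Var 0) (Var 1) (Var 2))"
    by (auto simp: logic_of_def Field_G3)
  then show False
    by (simp add: fork_axiom_def all_above_G3 V_def)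
qed

lemma fork_axiom_not_in_R2: "fork_axiom (Var 0) (Var 1) (Var 2) \<notin> logic_of {R2}"
proof
  assume "fork_axiom (Var 0) (Var 1) (Var 2) \<in> logic_of {R2}"
  \<comment> \<open>Here 1 and 2 are the incomparable worlds, and neither is maximal.\<close>
  moreover define V :: "nat \<Rightarrow> nat set" where "V x = (if x = 0 then {1, 3} else if x = 1 then {2, 3} else {3})" for x
  moreover have "V x \<in> upsets R2" for x
    by (auto simp: V_def upsets_R2)
  ultimately have "forces R2 V 0 (fork_axiom (Var 0) (Var 1) (Var 2))"
    by (auto simp: logic_of_def Field_R2)
  then show False
    by (simp add: fork_axiom_def all_above_R2 V_def)
qed


section \<open>Jankov's formula\<close>

lemma Conjunction_forces:
  "forces r V w (Conjunction As) \<longleftrightarrow> (\<forall>A\<in>set As. forces r V w A)"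
  by (induction As) (auto simp: Conjunction_def)

lemma set_diagram:
  assumes "is_frame r"
  shows "set (diagram r) = insert (Iff (upset_var {}) Bot) (\<Union>U\<in>upsets r. \<Union>W\<in>upsets r.
    {Iff (upset_var (U \<inter> W)) (And (upset_var U) (upset_var W)),
     Iff (upset_var (U \<union> W)) (Or (upset_var U) (upset_var W)),
     Iff (upset_var (upset_imp r U W)) (Imp (upset_var U) (upset_var W))})"
  using set_upset_list[OF is_frameD(4)[OF assms]] by (auto simp: diagram_def)

lemma upset_imp_in_upsets: "trans r \<Longrightarrow> upset_imp r U W \<in> upsets r"
  by (auto simp: upset_imp_def upsets_def dest: transD FieldI2)

lemma upset_without_root:
  assumes "is_frame r"
  shows "Field r - {frame_root r} \<in> upsets r" "U \<in> upsets r \<Longrightarrow> frame_root r \<in> U \<Longrightarrow> U = Field r"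
    "frame_root r \<in> Field r"
proof -
  obtain w where w: "is_root r w" "frame_root r = w"
    using assms root_eq[OF assms] by (auto simp: is_frame_def)
  show "Field r - {frame_root r} \<in> upsets r" "U \<in> upsets r \<Longrightarrow> frame_root r \<in> U \<Longrightarrow> U = Field r"
    "frame_root r \<in> Field r"
    using w is_frameD(3)[OF assms] by (auto simp: upsets_def is_root_def dest: antisymD FieldI2)
qed

lemma jankov_not_in_logic_of:
  assumes "is_frame F"
  shows "jankov F \<notin> logic_of {F}"
proof
  assume J: "jankov F \<in> logic_of {F}"
  \<comment> \<open>Each variable coding an up-set receives that up-set. The empty set is a default
    for all other indices, which keeps \<open>V\<close> a valuation.\<close>
  define V where "V x = (if set_decode x \<in> upsets F then set_decode x else {})" for x
  have V: "V x \<in> upsets F" for x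
    by (auto simp: V_def upsets_def)
  have var: "forces F V w (upset_var U) \<longleftrightarrow> w \<in> U" if "U \<in> upsets F" for U w
    using that finite_subset[OF _ is_frameD(4)[OF assms]] by (auto simp: upset_var_def V_def upsets_def)
  have [simp]: "{} \<in> upsets F" by (simp add: upsets_def)
  have [simp]: "U \<inter> W \<in> upsets F" "U \<union> W \<in> upsets F" "upset_imp F U W \<in> upsets F"
    if "U \<in> upsets F" "W \<in> upsets F" for U W
    using that upset_imp_in_upsets[OF is_frameD(1)[OF assms]] by (auto simp: upsets_def)
  have imp: "u \<in> upset_imp F U W \<longleftrightarrow> (\<forall>v. (u, v) \<in> F \<longrightarrow> v \<in> U \<longrightarrow> v \<in> W)" if "(w, u) \<in> F" for w u U W
    using that by (auto simp: upset_imp_def dest: FieldI2)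
  have "forces F V w A" if "A \<in> set (diagram F)" for w A
    using that unfolding set_diagram[OF assms] by (auto simp: Iff_def var imp)
  then have "forces F V (frame_root F) (Conjunction (diagram F))"
    by (simp add: Conjunction_forces)
  moreover have "forces F V (frame_root F) (jankov F)"
    using J V upset_without_root(3)[OF assms] by (auto simp: logic_of_def)
  ultimately show False
    using is_frameD(2)[OF assms upset_without_root(3)[OF assms]]
    by (auto simp: jankov_def var[OF upset_without_root(1)[OF assms]])
qed

context intermediate
begin

lemma world_Conjunction: "world L v \<Longrightarrow> Conjunction As \<in> v \<longleftrightarrow> set As \<subseteq> v"
  by (induction As) (auto simp: Conjunction_def world_Imp)

lemma world_Iff: "world L v \<Longrightarrow> Iff A B \<in> v \<Longrightarrow> A \<in> v \<longleftrightarrow> B \<in> v"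
  unfolding Iff_def using world_mp world_And by meson

text \<open>Suppose \<open>F\<close> refutes some \<open>A\<close> in \<open>L\<close>, and a world
  contains the diagram. Replacing each variable by the name of its value turns \<open>A\<close> into
  an equivalent of the name of its truth set. That set misses the root, so the name of the second
  largest up-set follows.\<close>

lemma jankov_iff_omits:
  assumes F: "is_frame F"
  shows "jankov F \<in> L \<longleftrightarrow> omits L F"
proof
  show "omits L F" if "jankov F \<in> L"
    using that jankov_not_in_logic_of[OF F] by (auto simp: omits_def)
next
  assume "omits L F"
  then obtain A V w where A: "A \<in> L" and V: "\<And>x. V x \<in> upsets F" and "w \<in> Field F" "\<not> forces F V w A"
    by (auto simp: omits_def logic_of_def)
  define ext where "ext C = {u \<in> Field F. forces F V u C}" for C
  have ext: "ext C \<in> upsets F" for C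
    unfolding ext_def by (rule forced_upset[OF is_frameD(1)[OF F] V])
  show "jankov F \<in> L"
  proof (rule mem_if_worlds, unfold jankov_def, rule ccontr)
    fix x assume x: "world L x"
      "Imp (Conjunction (diagram F)) (upset_var (Field F - {frame_root F})) \<notin> x"
    then obtain y where y: "world L y" "x \<subseteq> y" "set (diagram F) \<subseteq> y"
      "upset_var (Field F - {frame_root F}) \<notin> y"
      using world_Imp_refute world_Conjunction by metis
    let ?\<sigma> = "\<lambda>z. upset_var (V z)"
    \<comment> \<open>The diagram makes naming an up-set a homomorphism at every world above
      \<open>y\<close>.\<close>
    have "subst ?\<sigma> C \<in> v \<longleftrightarrow> upset_var (ext C) \<in> v" if v: "world L v" "y \<subseteq> v" for C v
      using v
    proof (induction C arbitrary: v)
      case (Var z)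
      have "ext (Var z) = V z" using V[of z] by (auto simp: ext_def upsets_def)
      then show ?case by simp
    next
      case Bot
      have "Iff (upset_var {}) Bot \<in> v"
        using y(3) Bot(2) unfolding set_diagram[OF F] by blast
      moreover have "ext Bot = {}" by (simp add: ext_def)
      ultimately show ?case using world_Iff Bot(1) by (metis subst.simps(2))
    next
      case (And C D)
      have "Iff (upset_var (ext C \<inter> ext D)) (And (upset_var (ext C)) (upset_var (ext D))) \<in> v"
        using y(3) And.prems(2) ext unfolding set_diagram[OF F] by blast
      moreover have "ext (And C D) = ext C \<inter> ext D" by (auto simp: ext_def)
      ultimately show ?case using world_Iff[OF And.prems(1)] And by simp
    next
      case (Or C D)
      have "Iff (upset_var (ext C \<union> ext D)) (Or (upset_var (ext C)) (upset_var (ext D))) \<in> v"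
        using y(3) Or.prems(2) ext unfolding set_diagram[OF F] by blast
      moreover have "ext (Or C D) = ext C \<union> ext D" by (auto simp: ext_def)
      ultimately show ?case using world_Iff[OF Or.prems(1)] Or by simp
    next
      case (Imp C D)
      have "Iff (upset_var (upset_imp F (ext C) (ext D))) (Imp (upset_var (ext C)) (upset_var (ext D))) \<in> v"
        using y(3) Imp.prems(2) ext unfolding set_diagram[OF F] by blast
      moreover have "ext (Imp C D) = upset_imp F (ext C) (ext D)"
        by (auto simp: ext_def upset_imp_def dest: FieldI2)
      moreover have "subst ?\<sigma> (Imp C D) \<in> v \<longleftrightarrow> Imp (upset_var (ext C)) (upset_var (ext D)) \<in> v"
      proof -
        have "subst ?\<sigma> C \<in> u \<longleftrightarrow> upset_var (ext C) \<in> u" "subst ?\<sigma> D \<in> u \<longleftrightarrow> upset_var (ext D) \<in> u"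
          if "world L u" "v \<subseteq> u" for u
          using Imp.IH[of u] Imp.prems(2) that by auto
        then show ?thesis
          using Imp.prems(1) by (simp add: world_Imp cong: imp_cong)
      qed
      ultimately show ?case using world_Iff[OF Imp.prems(1)] by simp
    qed
    then have extA: "upset_var (ext A) \<in> y"
      using y(1) mem_world subst_closed[OF A] by blast
    let ?R = "Field F - {frame_root F}"
    have "ext A \<noteq> Field F"
      using \<open>w \<in> Field F\<close> \<open>\<not> forces F V w A\<close> by (auto simp: ext_def)
    then have "frame_root F \<notin> ext A"
      using upset_without_root(2)[OF F ext] by blast
    \<comment> \<open>Inclusion is turned into an equation, because the diagram speaks about
      intersections.\<close>
    then have "ext A \<inter> ?R = ext A"
      by (auto simp: ext_def)
    moreover have "Iff (upset_var (ext A \<inter> ?R)) (And (upset_var (ext A)) (upset_var ?R)) \<in> y"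
      using y(3) ext upset_without_root(1)[OF F] unfolding set_diagram[OF F] by blast
    ultimately show False
      using world_Iff[OF y(1)] extA y(1,4) by (metis world_And)
  qed
qed

end


section \<open>Logics without projective approximation\<close>

text \<open>Everything is relative to the cone of \<open>w\<close>. With the identity this is
  locality of forcing; with a proper map it folds one cone onto another.\<close>

lemma forces_p_morphism:
  assumes "is_frame r" "\<And>v. v \<in> Field r \<Longrightarrow> (w, v) \<in> r \<Longrightarrow> f ` (r `` {v}) = s `` {f v}"
    and "\<And>v x. v \<in> Field r \<Longrightarrow> (w, v) \<in> r \<Longrightarrow> v \<in> V x \<longleftrightarrow> f v \<in> V' x"
    and "u \<in> Field r" "(w, u) \<in> r"
  shows "forces r V u C \<longleftrightarrow> forces s V' (f u) C"
  using assms(4,5)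
proof (induction C arbitrary: u)
  case (Imp C D)
  have "forces r V v C \<longleftrightarrow> forces s V' (f v) C" "forces r V v D \<longleftrightarrow> forces s V' (f v) D"
    if "(u, v) \<in> r" for v
    using Imp.IH[of v] that transD[OF is_frameD(1)[OF assms(1)] Imp.prems(2) that] FieldI2[OF that] by auto
  then have "forces r V u (Imp C D) \<longleftrightarrow> (\<forall>k \<in> f ` (r `` {u}). forces s V' k C \<longrightarrow> forces s V' k D)"
    by auto
  then show ?case
    unfolding assms(2)[OF Imp.prems] by auto
qed (use assms(3) in auto)

lemma forces_cong_above:
  assumes "is_frame r" "w \<in> Field r" "\<And>v x. (w, v) \<in> r \<Longrightarrow> v \<in> V x \<longleftrightarrow> v \<in> V' x"
  shows "forces r V w C \<longleftrightarrow> forces r V' w C"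
  using forces_p_morphism[of r w "\<lambda>v. v" r V V' w C] assms is_frameD(2)[OF assms(1,2)] by simp

text \<open>A projective unifier changes a valuation forcing \<open>B\<close> above the root at the root only;
  here upward closure leaves it no freedom there either.\<close>

lemma projective_forces_root:
  assumes F: "is_frame F" "is_root F w" and \<epsilon>: "projective_unifier (logic_of {F}) \<epsilon> B"
    and U: "\<And>x. U x \<in> upsets F"
    and B: "\<And>u. u \<in> Field F \<Longrightarrow> u \<noteq> w \<Longrightarrow> forces F U u B"
    and proper: "\<And>x. \<exists>u \<in> Field F. u \<noteq> w \<and> u \<notin> U x"
  shows "forces F U w B"
proof -
  have w: "w \<in> Field F" using F(2) by (simp add: is_root_def)
  have eq: "forces F U u (\<epsilon> x) \<longleftrightarrow> u \<in> U x" if u: "u \<in> Field F" "u \<noteq> w" for u x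
  proof -
    have "forces F U u (Iff (\<epsilon> x) (Var x))"
      using \<epsilon> derives_forces[OF _ F(1) U u(1) B[OF u]] by (auto simp: projective_unifier_def)
    then show ?thesis using is_frameD(2)[OF F(1) u(1)] by (auto simp: Iff_def)
  qed
  have "\<not> forces F U w (\<epsilon> x)" "w \<notin> U x" for x
  proof -
    obtain u where u: "u \<in> Field F" "u \<noteq> w" "u \<notin> U x" using proper by blast
    then have "(w, u) \<in> F" using F(2) by (simp add: is_root_def)
    then show "\<not> forces F U w (\<epsilon> x)" "w \<notin> U x"
      using forces_mono[of F U, OF is_frameD(1)[OF F(1)] U] eq[OF u(1,2)] U[of x] u(3)
      by (auto simp: upsets_def)
  qed
  then have "u \<in> Field F \<and> forces F U u (\<epsilon> x) \<longleftrightarrow> u \<in> U x" for u x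
    using eq[of u x] U[of x] unfolding upsets_def by (cases "u = w") blast+
  then have "{u \<in> Field F. forces F U u (\<epsilon> x)} = U x" for x
    by blast
  moreover have "forces F U w (subst \<epsilon> B)"
    using \<epsilon> U w by (auto simp: projective_unifier_def unifier_def logic_of_def)
  ultimately show ?thesis using w by (simp add: forces_subst)
qed

lemma unified_forces:
  assumes "unifier (logic_of {F}) \<sigma> B" "w \<in> Field F" "\<And>x. V x \<in> upsets F"
  shows "forces F (\<lambda>x. {u \<in> Field F. forces F V u (\<sigma> x)}) w B"
  using assms by (simp add: forces_subst[symmetric] unifier_def logic_of_def)

text \<open>As \<open>R2\<close> has a top, one of \<open>Neg (Var 0)\<close> and
  \<open>Neg (Neg (Var 0))\<close> holds everywhere. So \<open>?\<sigma>\<close> makes one of the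
  variables 0 and 1 true and gives the other the value of \<open>?D\<close>, which may be the top
  alone; this unifies linearity. Both choices together put every \<open>B\<close> unified by
  \<open>?\<sigma>\<close> at the worlds 1 and 2 under \<open>U\<close>. Projectivity extends
  \<open>B\<close> to the root, where \<open>?A\<close> fails.\<close>

lemma no_projective_approximation_R2: "\<not> projective_approximation (logic_of {R2})"
proof
  assume "projective_approximation (logic_of {R2})"
  let ?A = "Or (Imp (Var 0) (Var 1)) (Imp (Var 1) (Var 0))"
  let ?D = "Or (Var 1) (Neg (Var 1))"
  let ?\<sigma> = "\<lambda>x::nat. Or (if x = 0 then Neg (Neg (Var 0)) else Neg (Var 0)) ?D"
  have "unifier (logic_of {R2}) ?\<sigma> ?A"
    unfolding unifier_def logic_of_def
  proof (intro CollectI ballI allI impI)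
    fix r :: "nat rel" and V :: "nat \<Rightarrow> nat set" and w assume "r \<in> {R2}" and V: "\<forall>x. V x \<in> upsets r" and "w \<in> Field r"
    then have "r = R2" "w \<in> {0, 1, 2, 3}" by (auto simp: Field_R2)
    moreover have "V 0 \<in> upsets R2" "V 1 \<in> upsets R2" using V \<open>r = R2\<close> by auto
    ultimately show "forces r V w (subst ?\<sigma> ?A)"
      unfolding upsets_R2 by (elim conjE insertE emptyE; simp add: all_above_R2 ex_above_R2; argo)
  qed
  then obtain B \<epsilon> where B: "unifier (logic_of {R2}) ?\<sigma> B" "projective_unifier (logic_of {R2}) \<epsilon> B"
    "derives (logic_of {R2}) {B} ?A"
    using \<open>projective_approximation (logic_of {R2})\<close> unfolding projective_approximation_def by meson
  define U :: "nat \<Rightarrow> nat set" where "U x = (if x = 0 then {1, 3} else {2, 3})" for x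
  have U: "U x \<in> upsets R2" for x
    by (auto simp: U_def upsets_R2)
  have B1: "forces R2 U 1 B"
  proof -
    \<comment> \<open>Variable 0 becomes true everywhere, the others take the value of
      \<open>?D\<close>, the top: above 1 this is \<open>U\<close>.\<close>
    define V :: "nat \<Rightarrow> nat set" where "V x = (if x = 0 then {0, 1, 2, 3} else {3})" for x
    have "V x \<in> upsets R2" for x by (auto simp: V_def upsets_R2)
    then have "forces R2 (\<lambda>x. {u \<in> Field R2. forces R2 V u (?\<sigma> x)}) 1 B"
      by (intro unified_forces B(1)) (auto simp: Field_R2)
    also have "?this \<longleftrightarrow> forces R2 U 1 B"
    proof (rule forces_cong_above[OF is_frame_R2])
      fix v x assume "(1, v) \<in> R2"
      then have "v = 1 \<or> v = 3" by (auto simp: R2_eq)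
      then show "v \<in> {u \<in> Field R2. forces R2 V u (?\<sigma> x)} \<longleftrightarrow> v \<in> U x"
        by (elim disjE; cases "x = 0"; simp add: Field_R2 U_def V_def all_above_R2 ex_above_R2; auto simp: R2_eq)
    qed (simp add: Field_R2)
    finally show ?thesis .
  qed
  have B2: "forces R2 U 2 B"
  proof -
    \<comment> \<open>The opposite choice, which is \<open>U\<close> above 2.\<close>
    define V :: "nat \<Rightarrow> nat set" where "V x = (if x = 0 then {} else {3})" for x
    have "V x \<in> upsets R2" for x by (auto simp: V_def upsets_R2)
    then have "forces R2 (\<lambda>x. {u \<in> Field R2. forces R2 V u (?\<sigma> x)}) 2 B"
      by (intro unified_forces B(1)) (auto simp: Field_R2)
    also have "?this \<longleftrightarrow> forces R2 U 2 B"
    proof (rule forces_cong_above[OF is_frame_R2])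
      fix v x assume "(2, v) \<in> R2"
      then have "v = 2 \<or> v = 3" by (auto simp: R2_eq)
      then show "v \<in> {u \<in> Field R2. forces R2 V u (?\<sigma> x)} \<longleftrightarrow> v \<in> U x"
        by (elim disjE; cases "x = 0"; simp add: Field_R2 U_def V_def all_above_R2 ex_above_R2; auto simp: R2_eq)
    qed (simp add: Field_R2)
    finally show ?thesis .
  qed
  have B3: "forces R2 U 3 B"
    by (rule forces_mono[of _ U, OF is_frameD(1)[OF is_frame_R2] U B2]) (simp add: R2_eq)
  have "forces R2 U 0 B"
  proof (rule projective_forces_root[OF is_frame_R2 is_root_R2 B(2) U])
    show "forces R2 U u B" if "u \<in> Field R2" "u \<noteq> 0" for u
      using that B1 B2 B3 by (auto simp: Field_R2)
    show "\<exists>u\<in>Field R2. u \<noteq> 0 \<and> u \<notin> U x" for x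
      by (auto simp: Field_R2 U_def)
  qed
  then have "forces R2 U 0 ?A"
    using derives_forces[of _ _ _ U, OF B(3) is_frame_R2 U] by (simp add: Field_R2)
  then show False
    by (simp add: U_def all_above_R2 ex_above_R2)
qed

text \<open>A value of \<open>?\<sigma>\<close> never separates 2 from 3, and this suffices for
  \<open>?A\<close>. The valuation \<open>U\<close> does separate them, and \<open>?A\<close> fails
  at its root. Yet every \<open>B\<close> unified by \<open>?\<sigma>\<close> holds at 1, 2 and 3
  under \<open>U\<close>, so a projective one would hold at 0.\<close>

lemma no_projective_approximation_G3: "\<not> projective_approximation (logic_of {G3})"
proof
  assume "projective_approximation (logic_of {G3})"
  let ?A = "Or (Imp (Neg (Neg (Var 0))) (Var 0)) (Neg (Neg (Var 0)))"
  let ?\<sigma> = "\<lambda>x::nat. Or (Neg (Neg (Var 0))) (And (Neg (Var 0)) (Neg (Neg (Var 1))))"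
  have "unifier (logic_of {G3}) ?\<sigma> ?A"
    unfolding unifier_def logic_of_def
  proof (intro CollectI ballI allI impI)
    fix r :: "nat rel" and V :: "nat \<Rightarrow> nat set" and w assume "r \<in> {G3}" and V: "\<forall>x. V x \<in> upsets r" and "w \<in> Field r"
    then have r: "r = G3" and w: "w \<in> {0, 1, 2, 3}" by (auto simp: Field_G3)
    have "2 \<in> V 0 \<longrightarrow> 3 \<in> V 0"
      using V r by (auto simp: upsets_G3)
    then have "forces G3 V 3 (?\<sigma> 0) \<Longrightarrow> forces G3 V 2 (?\<sigma> 0)"
      by (simp add: all_above_G3 ex_above_G3) argo
    moreover have "forces G3 V w (Or (Imp (Neg (Neg S)) S) (Neg (Neg S)))"
      if "forces G3 V 3 S \<Longrightarrow> forces G3 V 2 S" for S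
      using w that by (elim insertE emptyE; simp add: all_above_G3 ex_above_G3; argo)
    ultimately show "forces r V w (subst ?\<sigma> ?A)"
      unfolding r subst.simps by blast
  qed
  then obtain B \<epsilon> where B: "unifier (logic_of {G3}) ?\<sigma> B" "projective_unifier (logic_of {G3}) \<epsilon> B"
    "derives (logic_of {G3}) {B} ?A"
    using \<open>projective_approximation (logic_of {G3})\<close> unfolding projective_approximation_def by meson
  define U :: "nat \<Rightarrow> nat set" where "U x = {3}" for x
  have U: "U x \<in> upsets G3" for x
    by (auto simp: U_def upsets_G3)
  have B1: "forces G3 U 1 B"
  proof -
    define V :: "nat \<Rightarrow> nat set" where "V x = {}" for x
    have "V x \<in> upsets G3" for x by (auto simp: V_def upsets_G3)
    then have "forces G3 (\<lambda>x. {u \<in> Field G3. forces G3 V u (?\<sigma> x)}) 1 B"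
      by (intro unified_forces B(1)) (auto simp: Field_G3)
    also have "?this \<longleftrightarrow> forces G3 U 1 B"
    proof (rule forces_cong_above[OF is_frame_G3])
      fix v x assume "(1, v) \<in> G3"
      then have "v = 1" by (auto simp: G3_def)
      then show "v \<in> {u \<in> Field G3. forces G3 V u (?\<sigma> x)} \<longleftrightarrow> v \<in> U x"
        by (simp add: Field_G3 U_def V_def all_above_G3 ex_above_G3; auto simp: G3_def)
    qed (simp add: Field_G3)
    finally show ?thesis .
  qed
  have B2: "forces G3 U 2 B"
  proof -
    \<comment> \<open>The separation that \<open>?\<sigma>\<close> cannot achieve at 2 is achieved
      at 0: variable 0 is open there and settled above, so \<open>?\<sigma>\<close> fails at the
      root only.\<close>
    define V :: "nat \<Rightarrow> nat set" where "V x = (if x = 0 then {1} else {3})" for x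
    have "V x \<in> upsets G3" for x by (auto simp: V_def upsets_G3)
    then have "forces G3 (\<lambda>x. {u \<in> Field G3. forces G3 V u (?\<sigma> x)}) 0 B"
      by (intro unified_forces B(1)) (auto simp: Field_G3)
    moreover have "forces G3 V u (?\<sigma> x) \<longleftrightarrow> u \<in> {1, 2, 3}" if "u \<in> {0, 1, 2, 3}" for u and x :: nat
      using that by (elim insertE emptyE; simp add: all_above_G3 ex_above_G3; simp add: V_def)
    then have "{u \<in> Field G3. forces G3 V u (?\<sigma> x)} = {1, 2, 3}" for x
      by (auto simp: Field_G3)
    ultimately have "forces G3 (\<lambda>x. {1, 2, 3}) 0 B" by simp
    \<comment> \<open>Collapsing all worlds but the root turns the frame into the chain of 2 and 3,
      with \<open>U\<close> on it.\<close>
    moreover define f :: "nat \<Rightarrow> nat" where "f u = (if u = 0 then 2 else 3)" for u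
    have "forces G3 (\<lambda>x. {1, 2, 3}) 0 B \<longleftrightarrow> forces G3 U (f 0) B"
    proof (rule forces_p_morphism[where w = 0, OF is_frame_G3])
      have im: "G3 `` {0} = {0, 1, 2, 3}" "G3 `` {1} = {1}" "G3 `` {2} = {2, 3}" "G3 `` {3} = {3}"
        by (auto simp: G3_def)
      have f: "f 0 = 2" "f 1 = 3" "f 2 = 3" "f 3 = 3"
        by (simp_all add: f_def)
      fix v assume "v \<in> Field G3"
      then have v: "v = 0 \<or> v = 1 \<or> v = 2 \<or> v = 3" by (auto simp: Field_G3)
      then show "f ` G3 `` {v} = G3 `` {f v}"
        by (elim disjE; simp only: im f image_insert image_empty; auto)
      show "v \<in> {1, 2, 3} \<longleftrightarrow> f v \<in> U x" for x
        using v by (auto simp: f_def U_def)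
    qed (simp_all add: Field_G3 G3_def Id_on_iff)
    ultimately show ?thesis by (simp add: f_def)
  qed
  have B3: "forces G3 U 3 B"
    by (rule forces_mono[of _ U, OF is_frameD(1)[OF is_frame_G3] U B2]) (simp add: G3_def)
  have "forces G3 U 0 B"
  proof (rule projective_forces_root[OF is_frame_G3 is_root_G3 B(2) U])
    show "forces G3 U u B" if "u \<in> Field G3" "u \<noteq> 0" for u
      using that B1 B2 B3 by (auto simp: Field_G3)
    show "\<exists>u\<in>Field G3. u \<noteq> 0 \<and> u \<notin> U x" for x
      by (auto simp: Field_G3 U_def)
  qed
  then have "forces G3 U 0 ?A"
    using derives_forces[of _ _ _ U, OF B(3) is_frame_G3 U] by (simp add: Field_G3)
  then show False
    by (simp add: all_above_G3 ex_above_G3; simp add: U_def)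
qed


section \<open>Completeness for chains topped by forks\<close>

text \<open>The root of the fork is \<open>d\<close>; it prolongs the chain to \<open>d + 1\<close>
  elements, and the worlds after \<open>d\<close> are the pairwise incomparable maximal
  ones.\<close>

lemma H_pa_frame_eq:
  "frame_sum (chain_frame d) (dir_image (fork_frame m) (\<lambda>i. d + i)) =
    {(i, j). j \<le> d + m \<and> (i = j \<or> i \<le> d \<and> i \<le> j)}" (is "?l = ?r")
proof -
  have "dir_image (fork_frame m) (\<lambda>i. d + i) = {(i, j). d \<le> i \<and> j \<le> d + m \<and> (i = j \<or> i = d \<and> d \<le> j)}"
    unfolding dir_image_def fork_frame_def
    by (auto simp: le_iff_add)
  then have "(i, j) \<in> ?l \<longleftrightarrow> i \<le> j \<and> j < d \<or> d \<le> i \<and> j \<le> d + m \<and> (i = j \<or> i = d \<and> d \<le> j) \<or>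
      i < d \<and> d \<le> j \<and> j \<le> d + m" for i j
    unfolding frame_sum_def Field_chain Field_shift by (simp add: chain_frame_def)
  moreover have "(i \<le> j \<and> j < d \<or> d \<le> i \<and> j \<le> d + m \<and> (i = j \<or> i = d \<and> d \<le> j) \<or>
      i < d \<and> d \<le> j \<and> j \<le> d + m) \<longleftrightarrow> (i, j) \<in> ?r" for i j
    by (simp, presburger)
  ultimately show ?thesis by (simp only: set_eq_iff split_paired_All simp_thms)
qed

lemma fork_axiom_in_logic_of_H_pa: "fork_axiom p q s \<in> logic_of H_pa"
  unfolding logic_of_def
proof (intro CollectI ballI allI impI)
  fix r :: "nat rel" and V :: "nat \<Rightarrow> nat set" and w assume r: "r \<in> H_pa" and V: "\<forall>x. V x \<in> upsets r" and w: "w \<in> Field r"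
  obtain d m where eq: "r = {(i, j). j \<le> d + m \<and> (i = j \<or> i \<le> d \<and> i \<le> j)}"
    using r by (auto simp: H_pa_def H_pa_frame_eq)
  have mono: "forces r V u A" if "(v, u) \<in> r" "forces r V v A" for A u v
    using forces_mono[OF is_frameD(1)[OF is_frame_H_pa[OF r]]] V that by blast
  show "forces r V w (fork_axiom p q s)"
  proof (rule ccontr)
    assume "\<not> ?thesis"
    then obtain y y' z where y: "(w, y) \<in> r" "forces r V y p" "\<not> forces r V y q" "\<not> forces r V y s"
      and y': "(y, y') \<in> r" "forces r V y' s"
      and z: "(w, z) \<in> r" "forces r V z q" "\<not> forces r V z p"
      by (auto simp: fork_axiom_def)
    \<comment> \<open>Having a proper successor, \<open>y\<close> lies on the chain and is
      comparable with every world.\<close>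
    have "y \<noteq> y'" using y y' by blast
    then have "(y, z) \<in> r \<or> (z, y) \<in> r"
      using y(1) y'(1) z(1) unfolding eq by auto
    then show False using mono y z by blast
  qed
qed

primrec subformulas :: "fm \<Rightarrow> fm set" where
  "subformulas (Var x) = {Var x}"
| "subformulas Bot = {Bot}"
| "subformulas (And A B) = insert (And A B) (subformulas A \<union> subformulas B)"
| "subformulas (Or A B) = insert (Or A B) (subformulas A \<union> subformulas B)"
| "subformulas (Imp A B) = insert (Imp A B) (subformulas A \<union> subformulas B)"

lemma self_subformula: "A \<in> subformulas A"
  by (cases A) auto

lemma finite_subformulas: "finite (subformulas A)"
  by (induction A) auto

section \<open>Filtration of a cone whose non-maximal worlds are comparable with all others\<close>

locale fork_logic = intermediate +
  assumes fork_axiom: "fork_axiom p q s \<in> L"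
begin

text \<open>Formulas separating \<open>y\<close> and \<open>z\<close>, and one gained in a proper
  extension of \<open>y\<close>, refute an instance of the axiom at \<open>w\<close>.\<close>

lemma comparable:
  assumes "world L w" and y: "world L y" "w \<subseteq> y" and z: "world L z" "w \<subseteq> z"
    and nonmax: "\<not> maximal_world L y"
  shows "y \<subseteq> z \<or> z \<subseteq> y"
proof (rule ccontr)
  assume "\<not> ?thesis"
  then obtain p q where pq: "p \<in> y" "p \<notin> z" "q \<in> z" "q \<notin> y" by blast
  obtain y' s where y': "world L y'" "y \<subseteq> y'" "s \<in> y'" "s \<notin> y"
    using nonmax y(1) unfolding maximal_world_def by blast
  then have "Neg s \<notin> y"
    using y(1) world_Neg by blast
  then have "Imp p (Or q (Or s (Neg s))) \<notin> w"
    using world_mp[OF y(1) pq(1), of "Or q (Or s (Neg s))"] y pq y'(4) by auto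
  moreover have "Imp q p \<notin> w"
    using world_mp[OF z(1) pq(3)] z(2) pq(2) by blast
  ultimately show False
    using mem_world[OF assms(1) fork_axiom[of p q s]] assms(1) by (simp add: fork_axiom_def)
qed

lemma logic_of_H_pa_subset: "logic_of H_pa \<subseteq> L"
proof (rule subsetI, rule ccontr)
  fix A assume A: "A \<in> logic_of H_pa" "A \<notin> L"
  then obtain w where w: "world L w" "A \<notin> w"
    using mem_if_worlds by blast
  define ty where "ty u = u \<inter> subformulas A" for u
  \<comment> \<open>The type of \<open>w\<close> is included even if \<open>w\<close> is maximal, so
    the chain is never empty.\<close>
  define N where "N = insert (ty w) {ty u | u. world L u \<and> w \<subseteq> u \<and> \<not> maximal_world L u}"
  define M where "M = {ty u | u. maximal_world L u \<and> w \<subseteq> u}"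
  have Pow: "N \<subseteq> Pow (subformulas A)" "M \<subseteq> Pow (subformulas A)"
    by (auto simp: N_def M_def ty_def)
  have fin: "finite N" "finite M" "\<And>X. X \<in> N \<Longrightarrow> finite X"
    by (meson Pow PowD finite_Pow_iff finite_subformulas finite_subset subsetD)+
  have card_N: "card X \<le> card (subformulas A)" if "X \<in> N" for X
    using Pow(1) that by (intro card_mono finite_subformulas) auto
  have chain: "X \<subseteq> Y \<or> Y \<subseteq> X" if "X \<in> N" "Y \<in> N" for X Y
    using that comparable[OF w(1)] unfolding N_def ty_def by blast
  have ty_w: "ty w \<subseteq> X" if "X \<in> N" for X
    using that by (auto simp: N_def ty_def)
  have below: "X \<subseteq> Y" if X: "X \<in> N" and Y: "Y \<in> M" for X Y
  proof -
    obtain v where v: "maximal_world L v" "w \<subseteq> v" "Y = ty v" using Y by (auto simp: M_def)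
    have "u \<subseteq> v" if "world L u" "w \<subseteq> u" "\<not> maximal_world L u" for u
      using comparable[OF w(1) that(1,2) maximal_worldD[OF v(1)] v(2) that(3)] v(1) that
      by (auto simp: maximal_world_def)
    then show ?thesis using X v by (auto simp: N_def ty_def)
  qed
  \<comment> \<open>The types in \<open>N\<close> form a chain and are thus told apart by their
    size. \<open>T i\<close> is the largest of size at most \<open>i\<close>, so types repeat over
    gaps; below the size of \<open>ty w\<close> it is \<open>ty w\<close>.\<close>
  define T where "T i = \<Union> (insert (ty w) {X \<in> N. card X \<le> i})" for i
  have T_in: "T i \<in> N" for i
  proof -
    have "subset.chain N (insert (ty w) {X \<in> N. card X \<le> i})"
      using chain by (auto simp: subset_chain_def N_def)
    then have "T i \<in> insert (ty w) {X \<in> N. card X \<le> i}"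
      unfolding T_def using fin(1) by (intro Union_in_chain) auto
    then show ?thesis by (auto simp: N_def)
  qed
  have T_mono: "T i \<subseteq> T j" if "i \<le> j" for i j
    using that by (force simp: T_def)
  have T_card: "T (card X) = X" if X: "X \<in> N" for X
  proof -
    have "Y \<subseteq> X" if "Y \<in> N" "card Y \<le> card X" for Y
      using chain[OF X that(1)] card_seteq[OF fin(3)[OF that(1)] _ that(2)] by blast
    then show ?thesis using X ty_w[OF X] by (auto simp: T_def)
  qed
  obtain m :: nat and h where M: "M = h ` {i. i < m}"
    using finite_imp_nat_seg_image_inj_on[OF fin(2)] by blast
  \<comment> \<open>No type is larger than \<open>d\<close>, so all of \<open>N\<close> occurs among
    the positions up to \<open>d\<close>. The types in \<open>M\<close> follow from
    \<open>d + 1\<close> on.\<close>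
  define d where "d = card (subformulas A)"
  define r where "r = {(i, j). j \<le> d + m \<and> (i = j \<or> i \<le> d \<and> i \<le> j)}"
  define G where "G j = (if j \<le> d then T j else h (j - Suc d))" for j
  have Field_r: "Field r = {..d + m}" by (auto simp: r_def Field_def)
  have r: "r \<in> H_pa" unfolding r_def H_pa_def by (auto simp: H_pa_frame_eq)
  have h_in: "h (j - Suc d) \<in> M" if "d < j" "j \<le> d + m" for j
    using that by (auto simp: M)
  have G_mono: "G i \<subseteq> G j" if "(i, j) \<in> r" for i j
    using that T_mono[of i j] below[OF T_in[of i] h_in[of j]] by (auto simp: G_def r_def)
  \<comment> \<open>This provides the positions refuting an implication; that implications persist
    upwards comes from \<open>G_mono\<close>.\<close>
  have realized: "\<exists>u. world L u \<and> G j = ty u \<and>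
      (\<forall>v. world L v \<longrightarrow> u \<subseteq> v \<longrightarrow> (\<exists>k. (j, k) \<in> r \<and> G k = ty v))"
    if j: "j \<le> d + m" for j
  proof (cases "j \<le> d")
    case True
    obtain u where u: "world L u" "w \<subseteq> u" "T j = ty u"
      using T_in[of j] w(1) by (auto simp: N_def)
    have "\<exists>k. (j, k) \<in> r \<and> G k = ty v" if v: "world L v" "u \<subseteq> v" for v
    proof (cases "maximal_world L v")
      case mx: True
      then have "ty v \<in> M" using u(2) v(2) by (auto simp: M_def)
      then obtain i where "i < m" "h i = ty v" by (auto simp: M)
      then have "(j, Suc (d + i)) \<in> r" "G (Suc (d + i)) = ty v" using True by (auto simp: r_def G_def)
      then show ?thesis by blast
    next
      case False
      then have v_in: "ty v \<in> N" using u(2) v by (auto simp: N_def)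
      \<comment> \<open>If the size of \<open>ty v\<close> is less than \<open>j\<close>, this type
        is still being repeated at \<open>j\<close>.\<close>
      let ?k = "max j (card (ty v))"
      have "T ?k = ty v"
      proof (cases "j \<le> card (ty v)")
        case le: True
        then show ?thesis using T_card[OF v_in] by (simp add: max_def)
      next
        case gt: False
        have "T j \<subseteq> ty v" using u(3) v(2) by (auto simp: ty_def)
        moreover have "ty v \<subseteq> T j" using T_mono[of "card (ty v)" j] T_card[OF v_in] gt by simp
        ultimately show ?thesis using gt by (simp add: max_def)
      qed
      moreover have "?k \<le> d" using True card_N[OF v_in] by (simp add: d_def)
      ultimately have "(j, ?k) \<in> r" "G ?k = ty v" using True by (auto simp: r_def G_def)
      then show ?thesis by blast
    qed
    moreover have "G j = ty u" using u True by (simp add: G_def)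
    ultimately show ?thesis using u(1) by blast
  next
    case False
    then obtain u where u: "maximal_world L u" "G j = ty u"
      using h_in[of j] j by (auto simp: G_def M_def)
    moreover have "(j, j) \<in> r" using j by (auto simp: r_def)
    moreover have "v = u" if "world L v" "u \<subseteq> v" for v
      using u(1) that by (simp add: maximal_world_def)
    ultimately show ?thesis using maximal_worldD by metis
  qed
  define V where "V x = {j. j \<le> d + m \<and> Var x \<in> G j}" for x
  have V: "V x \<in> upsets r" for x
  proof -
    have "j \<le> d + m" if "(i, j) \<in> r" for i j
      using that by (auto simp: r_def)
    then show ?thesis
      unfolding upsets_def Field_r V_def using G_mono by blast
  qed
  have truth: "forces r V j C \<longleftrightarrow> C \<in> G j" if "subformulas C \<subseteq> subformulas A" "j \<le> d + m" for C j
    using that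
  proof (induction C arbitrary: j)
    case (Var x)
    then show ?case by (simp add: V_def)
  next
    case Bot
    then show ?case using realized[of j] by (auto simp: ty_def)
  next
    case (And C D)
    then show ?case using realized[of j] self_subformula[of C] self_subformula[of D] by (auto simp: ty_def)
  next
    case (Or C D)
    then show ?case using realized[of j] self_subformula[of C] self_subformula[of D] by (auto simp: ty_def)
  next
    case (Imp C D)
    have sub: "C \<in> subformulas A" "D \<in> subformulas A" "Imp C D \<in> subformulas A"
      using Imp.prems(1) self_subformula[of C] self_subformula[of D] by auto
    obtain u where u: "world L u" "G j = ty u" "\<And>v. world L v \<Longrightarrow> u \<subseteq> v \<Longrightarrow> \<exists>k. (j, k) \<in> r \<and> G k = ty v"
      using realized[OF Imp.prems(2)] by blast
    have "forces r V j (Imp C D) \<longleftrightarrow> (\<forall>k. (j, k) \<in> r \<longrightarrow> C \<in> G k \<longrightarrow> D \<in> G k)"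
      using Imp by (auto simp: r_def)
    also have "\<dots> \<longleftrightarrow> Imp C D \<in> G j"
    proof
      assume *: "\<forall>k. (j, k) \<in> r \<longrightarrow> C \<in> G k \<longrightarrow> D \<in> G k"
      have "D \<in> v" if v: "world L v" "u \<subseteq> v" "C \<in> v" for v
        using u(3)[OF v(1,2)] * v(3) sub by (auto simp: ty_def)
      then show "Imp C D \<in> G j" using u sub by (simp add: ty_def world_Imp)
    next
      assume I: "Imp C D \<in> G j"
      show "\<forall>k. (j, k) \<in> r \<longrightarrow> C \<in> G k \<longrightarrow> D \<in> G k"
      proof (intro allI impI)
        fix k assume k: "(j, k) \<in> r" "C \<in> G k"
        then obtain v where v: "world L v" "G k = ty v"
          using realized[of k] by (auto simp: r_def)
        have "Imp C D \<in> v" "C \<in> v" using I G_mono[OF k(1)] k(2) v(2) by (auto simp: ty_def)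
        then have "D \<in> v" using world_mp[OF v(1)] by blast
        then show "D \<in> G k" using v(2) sub by (simp add: ty_def)
      qed
    qed
    finally show ?case .
  qed
  have "ty w \<in> N" by (simp add: N_def)
  then have "card (ty w) \<le> d" "G (card (ty w)) = ty w"
    using T_card card_N by (auto simp: d_def G_def)
  then have "\<not> forces r V (card (ty w)) A"
    using truth[of A "card (ty w)"] w(2) by (auto simp: ty_def)
  moreover have "forces r V (card (ty w)) A"
    using A(1) r V Field_r \<open>card (ty w) \<le> d\<close> by (auto simp: logic_of_def)
  ultimately show False by blast
qed

end


section \<open>Projective approximation\<close>

definition big_and :: "fm set \<Rightarrow> fm" where
  "big_and X = Conjunction (SOME As. set As = X)"

definition big_or :: "fm set \<Rightarrow> fm" where
  "big_or X = foldr Or (SOME As. set As = X) Bot"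

lemma set_SOME_list: "finite X \<Longrightarrow> set (SOME As. set As = X) = X"
  by (metis (mono_tags, lifting) finite_list someI_ex)

lemma vars_big_and: "finite X \<Longrightarrow> vars (big_and X) = (\<Union>A\<in>X. vars A)"
proof -
  have "vars (Conjunction As) = (\<Union>A\<in>set As. vars A)" for As
    by (induction As) (auto simp: Conjunction_def)
  then show "finite X \<Longrightarrow> ?thesis" by (simp add: big_and_def set_SOME_list)
qed

lemma subst_Var [simp]: "subst Var A = A"
  by (induction A) auto

section \<open>Classical types and their double negations\<close>

definition literals :: "nat set \<Rightarrow> nat set \<Rightarrow> fm" where
  "literals P t = big_and ((\<lambda>x. if x \<in> t then Var x else Neg (Var x)) ` P)"

lemma vars_literals: "finite P \<Longrightarrow> vars (literals P t) = P"
  by (auto simp: literals_def vars_big_and split: if_splits)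

context intermediate
begin

lemma world_big_and: "world L v \<Longrightarrow> finite X \<Longrightarrow> subst \<sigma> (big_and X) \<in> v \<longleftrightarrow> (\<forall>A\<in>X. subst \<sigma> A \<in> v)"
proof -
  have "world L v \<Longrightarrow> subst \<sigma> (Conjunction As) \<in> v \<longleftrightarrow> (\<forall>A\<in>set As. subst \<sigma> A \<in> v)" for As
    by (induction As) (auto simp: Conjunction_def world_Imp)
  then show "world L v \<Longrightarrow> finite X \<Longrightarrow> ?thesis" by (simp add: big_and_def set_SOME_list)
qed

lemma world_big_or: "world L v \<Longrightarrow> finite X \<Longrightarrow> big_or X \<in> v \<longleftrightarrow> (\<exists>A\<in>X. A \<in> v)"
proof -
  have "world L v \<Longrightarrow> foldr Or As Bot \<in> v \<longleftrightarrow> (\<exists>A\<in>set As. A \<in> v)" for As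
    by (induction As) auto
  then show "world L v \<Longrightarrow> finite X \<Longrightarrow> ?thesis" by (simp add: big_or_def set_SOME_list)
qed

lemma world_subst_literals:
  assumes "world L v" "finite P"
  shows "subst \<sigma> (literals P t) \<in> v \<longleftrightarrow> (\<forall>x\<in>P. if x \<in> t then \<sigma> x \<in> v else Neg (\<sigma> x) \<in> v)"
  unfolding literals_def world_big_and[OF assms(1) finite_imageI[OF assms(2)]] ball_simps
  by (rule ball_cong) auto

lemma world_literals:
  assumes "world L v" "finite P"
  shows "literals P t \<in> v \<longleftrightarrow> (\<forall>x\<in>P. if x \<in> t then Var x \<in> v else Neg (Var x) \<in> v)"
  using world_subst_literals[OF assms, of Var t] by simp

lemma world_Neg_Neg_literals:
  assumes "world L v" "finite P" "Neg (Neg (literals P t)) \<in> v"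
    and "x \<in> P" "Var x \<in> v"
  shows "x \<in> t"
proof (rule ccontr)
  assume "x \<notin> t"
  obtain u where u: "world L u" "v \<subseteq> u" "literals P t \<in> u"
    using assms(1,3) unfolding world_Neg_Neg[OF assms(1)] by blast
  then have "Neg (Var x) \<in> u"
    using \<open>x \<notin> t\<close> assms(2,4) by (auto simp: world_literals)
  then show False
    using world_mp[OF u(1), of "Var x" Bot] u assms(5) by auto
qed

text \<open>The double negation of a type fixes the type of every maximal world above; the reverse
  inclusion follows by exchanging the types.\<close>

lemma Neg_Neg_literals_unique:
  assumes "world L v" "finite P" "t \<subseteq> P" "t' \<subseteq> P"
    and "Neg (Neg (literals P t)) \<in> v" "Neg (Neg (literals P t')) \<in> v"
  shows "t \<subseteq> t'"
proof -
  obtain u where u: "world L u" "v \<subseteq> u" "literals P t \<in> u"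
    using assms(1,5) unfolding world_Neg_Neg[OF assms(1)] by blast
  have "Neg (Neg (literals P t')) \<in> u" using u(2) assms(6) by blast
  then show ?thesis
    using world_Neg_Neg_literals[OF u(1) assms(2)] u(1,3) assms(2,3) by (auto simp: world_literals)
qed

lemma maximal_Neg_Neg_literals:
  assumes "maximal_world L v" "finite P"
  shows "literals P {x \<in> P. Var x \<in> v} \<in> v"
  using assms by (auto simp: world_literals maximal_worldD maximal_Imp)

end

text \<open>A type belongs to this set iff \<open>\<sigma>\<close> realises it in some world of the
  canonical model.\<close>

definition unified_types :: "fm set \<Rightarrow> nat set \<Rightarrow> (nat \<Rightarrow> fm) \<Rightarrow> nat set set" where
  "unified_types L P \<sigma> = {t. t \<subseteq> P \<and> Neg (subst \<sigma> (literals P t)) \<notin> L}"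

definition approximant :: "fm \<Rightarrow> nat set set \<Rightarrow> fm" where
  "approximant A S = And A (big_and ((\<lambda>t. Neg (literals (vars A) t)) ` (Pow (vars A) - S)))"

lemma finite_vars: "finite (vars A)"
  by (induction A) auto

lemma vars_approximant: "vars (approximant A S) = vars A"
  using finite_vars[of A] by (auto simp: approximant_def vars_big_and vars_literals)

section \<open>Approximants and the unifiers they stem from\<close>

context intermediate
begin

lemma world_approximant:
  assumes "world L v"
  shows "subst \<sigma> (approximant A S) \<in> v \<longleftrightarrow>
    subst \<sigma> A \<in> v \<and> (\<forall>t\<in>Pow (vars A) - S. Neg (subst \<sigma> (literals (vars A) t)) \<in> v)"
  using assms finite_vars[of A] by (simp add: approximant_def world_big_and)

lemma unifier_approximant:
  "unifier L \<sigma> A \<Longrightarrow> unifier L \<sigma> (approximant A (unified_types L (vars A) \<sigma>))"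
  unfolding unifier_def
  by (rule mem_if_worlds) (auto simp: world_approximant unified_types_def intro: mem_world)

lemma derives_approximant: "derives L {approximant A S} A"
  by (rule derives_if_worlds) (auto simp: approximant_def)

end

context fork_logic
begin

text \<open>Let \<open>B\<close> be the approximant and \<open>S\<close> its set of types. Each type in \<open>S\<close> is realised through
  \<open>\<sigma>\<close> in a maximal world; substituting into \<open>\<sigma>\<close> the disjunctions \<open>\<tau> y\<close> of the types whose realiser
  contains \<open>y\<close> gives a unifier \<open>\<theta>\<close> that does nothing at the maximal worlds with \<open>B\<close>. Below, the
  projective unifier retracts a world onto the worlds above it with \<open>B\<close> if one of these is not
  maximal, and acts as \<open>\<theta>\<close> otherwise.\<close>

lemma projective_approximant:
  fixes A \<sigma>
  defines "S \<equiv> unified_types L (vars A) \<sigma>"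
  assumes "unifier L \<sigma> A"
  shows "\<exists>\<epsilon>. projective_unifier L \<epsilon> (approximant A S)"
proof -
  let ?P = "vars A" and ?B = "approximant A S"
  let ?D = "\<lambda>t. Neg (Neg (literals ?P t))"
  note finP = finite_vars[of A]
  have S: "t \<subseteq> ?P" if "t \<in> S" for t
    using that by (simp add: S_def unified_types_def)
  then have finS: "finite S"
    using finP by (meson Pow_iff finite_Pow_iff finite_subset subsetI)
  have "\<exists>m. maximal_world L m \<and> subst \<sigma> (literals ?P t) \<in> m" if t: "t \<in> S" for t
  proof -
    obtain w where "world L w" "Neg (subst \<sigma> (literals ?P t)) \<notin> w"
      using t mem_if_worlds unfolding S_def unified_types_def by blast
    then obtain u where "world L u" "subst \<sigma> (literals ?P t) \<in> u"
      using world_Neg by blast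
    then show ?thesis
      using maximal_world_extends by blast
  qed
  then obtain mx where mx: "\<And>t. t \<in> S \<Longrightarrow> maximal_world L (mx t)"
    and mx_lit: "\<And>t. t \<in> S \<Longrightarrow> subst \<sigma> (literals ?P t) \<in> mx t"
    by metis
  \<comment> \<open>The formulas \<open>?D t\<close> exclude each other. So where
    \<open>?D t\<close> holds, substituting \<open>\<tau>\<close> evaluates formulas as in the
    chosen world \<open>mx t\<close>, and \<open>\<sigma>\<close> followed by \<open>\<tau>\<close>
    produces the type \<open>t\<close>.\<close>
  define \<tau> where "\<tau> y = big_or (?D ` {t \<in> S. Var y \<in> mx t})" for y
  define \<theta> where "\<theta> x = subst \<tau> (\<sigma> x)" for x
  define TT where "TT = big_or (?D ` S)"
  \<comment> \<open>The first conjunct is the weakest formula that agrees with the variable wherever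
    \<open>?B\<close> holds. The second cuts it down to \<open>\<theta> x\<close> where all worlds
    above with \<open>?B\<close> have settled their type.\<close>
  define \<epsilon> where "\<epsilon> x = (if x \<in> ?P
    then And (Imp ?B (Var x)) (Imp (Imp ?B TT) (\<theta> x)) else Var x)" for x
  have TT: "TT \<in> v \<longleftrightarrow> (\<exists>t\<in>S. ?D t \<in> v)" if "world L v" for v
    using that finS by (simp add: TT_def world_big_or)
  have \<tau>: "subst \<tau> C \<in> v \<longleftrightarrow> C \<in> mx t" if "world L v" "t \<in> S" "?D t \<in> v" for C t v
    using that
  proof (induction C arbitrary: v)
    case (Var y)
    have "t' = t" if "t' \<in> S" "?D t' \<in> v" for t'
      using that Var S Neg_Neg_literals_unique[OF Var(1) finP] by (simp add: subset_antisym)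
    moreover have "subst \<tau> (fm.Var y) \<in> v \<longleftrightarrow> (\<exists>t'\<in>S. fm.Var y \<in> mx t' \<and> ?D t' \<in> v)"
      unfolding subst.simps \<tau>_def using world_big_or[OF Var(1)] finS by auto
    ultimately show ?case
      using Var(2,3) by blast
  next
    case (Imp C D)
    have "subst \<tau> C \<in> u \<longleftrightarrow> C \<in> mx t" "subst \<tau> D \<in> u \<longleftrightarrow> D \<in> mx t" if "world L u" "v \<subseteq> u" for u
      using Imp.IH(1)[OF that(1)] Imp.IH(2)[OF that(1)] Imp.prems that by auto
    then have "subst \<tau> (Imp C D) \<in> v \<longleftrightarrow> (C \<in> mx t \<longrightarrow> D \<in> mx t)"
      using Imp.prems(1) by (simp add: world_Imp cong: imp_cong) blast
    then show ?case using maximal_Imp[OF mx[OF Imp.prems(2)]] by simp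
  qed (use maximal_worldD[OF mx] in auto)
  have \<theta>: "\<theta> x \<in> v \<longleftrightarrow> x \<in> t" if v: "world L v" "t \<in> S" "?D t \<in> v" and x: "x \<in> ?P" for x t v
  proof -
    have "\<sigma> x \<in> mx t \<longleftrightarrow> x \<in> t"
      using mx_lit[OF v(2)] x finP maximal_Imp[OF mx[OF v(2)], of "\<sigma> x" Bot] maximal_worldD[OF mx[OF v(2)]]
      by (auto simp: world_subst_literals split: if_splits)
    then show ?thesis using \<tau>[OF v] by (simp add: \<theta>_def)
  qed
  have maximal_B: "{x \<in> ?P. Var x \<in> k} \<in> S \<and> ?D {x \<in> ?P. Var x \<in> k} \<in> k"
    if k: "maximal_world L k" "?B \<in> k" for k
  proof -
    let ?t = "{x \<in> ?P. Var x \<in> k}"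
    have lit: "literals ?P ?t \<in> k"
      using maximal_Neg_Neg_literals[OF k(1) finP] .
    have "Neg (literals ?P ?t) \<notin> k"
      using world_Neg_NegD[OF maximal_worldD[OF k(1)]] world_Neg_NegI[OF maximal_worldD[OF k(1)] lit] by blast
    then have "?t \<in> S"
      using k(2) world_approximant[OF maximal_worldD[OF k(1)], of Var A S] by auto
    then show ?thesis
      using world_Neg_NegI[OF maximal_worldD[OF k(1)] lit] by blast
  qed
  have \<epsilon>_B: "\<epsilon> x \<in> v \<longleftrightarrow> Var x \<in> v" if v: "world L v" "?B \<in> v" for x v
  proof (cases "x \<in> ?P")
    case x: True
    have "Imp ?B (Var x) \<in> v" "Imp (Imp ?B TT) (\<theta> x) \<in> v" if "Var x \<in> v"
    proof -
      show "Imp ?B (Var x) \<in> v" using v(1) that by (auto simp: world_Imp)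
      have "\<theta> x \<in> u" if u: "world L u" "v \<subseteq> u" "Imp ?B TT \<in> u" for u
      proof -
        have "TT \<in> u" using world_mp[OF u(1) _ u(3)] u(2) v(2) by blast
        then obtain t where t: "t \<in> S" "?D t \<in> u" using TT[OF u(1)] by blast
        then have "x \<in> t"
          using world_Neg_Neg_literals[OF u(1) finP t(2) x] u(2) \<open>Var x \<in> v\<close> by blast
        then show ?thesis using \<theta>[OF u(1) t x] by simp
      qed
      then show "Imp (Imp ?B TT) (\<theta> x) \<in> v"
        by (subst world_Imp[OF v(1)]) blast
    qed
    moreover have "Var x \<in> v" if "Imp ?B (Var x) \<in> v"
      using world_mp[OF v that] .
    ultimately show ?thesis using x v(1) by (auto simp: \<epsilon>_def)
  qed (simp add: \<epsilon>_def)
  have "derives L {?B} (Iff (\<epsilon> x) (Var x))" for x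
  proof (rule derives_if_worlds)
    fix v assume v: "world L v" "{?B} \<subseteq> v"
    then have "\<epsilon> x \<in> u \<longleftrightarrow> Var x \<in> u" if "world L u" "v \<subseteq> u" for u
      using \<epsilon>_B that by blast
    then show "Iff (\<epsilon> x) (Var x) \<in> v"
      using v(1) by (auto simp: Iff_def world_Imp)
  qed
  moreover have "subst \<epsilon> ?B \<in> L"
  proof (rule mem_if_worlds)
    fix w assume w: "world L w"
    show "subst \<epsilon> ?B \<in> w"
    proof (cases "\<forall>k. world L k \<longrightarrow> w \<subseteq> k \<longrightarrow> ?B \<in> k \<longrightarrow> maximal_world L k")
      case True
      \<comment> \<open>Maximal worlds with \<open>?B\<close> have types in \<open>S\<close>, so
        \<open>Imp ?B TT\<close> holds; and \<open>\<theta> x\<close> implies the first conjunct, as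
        it agrees with the variable there.\<close>
      have "\<epsilon> x \<in> u \<longleftrightarrow> \<theta> x \<in> u" if x: "x \<in> ?P" and u: "world L u" "w \<subseteq> u" for x u
      proof -
        have B: "maximal_world L k" "TT \<in> k" "\<theta> x \<in> k \<longleftrightarrow> Var x \<in> k"
          if k: "world L k" "u \<subseteq> k" "?B \<in> k" for k
        proof -
          show m: "maximal_world L k" using True k u(2) by blast
          show "TT \<in> k" using TT[OF k(1)] maximal_B[OF m k(3)] by blast
          show "\<theta> x \<in> k \<longleftrightarrow> Var x \<in> k"
            using \<theta>[OF k(1) _ _ x] maximal_B[OF m k(3)] x by blast
        qed
        have "Imp ?B TT \<in> u" by (subst world_Imp[OF u(1)]) (use B in blast)
        then have "Imp (Imp ?B TT) (\<theta> x) \<in> u \<longleftrightarrow> \<theta> x \<in> u"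
          unfolding world_Imp[OF u(1), of "Imp ?B TT" "\<theta> x"] using u(1) by blast
        moreover have "Imp ?B (Var x) \<in> u" if "\<theta> x \<in> u"
          by (subst world_Imp[OF u(1)]) (use B that in blast)
        ultimately show ?thesis using x u(1) by (auto simp: \<epsilon>_def)
      qed
      then have "subst \<epsilon> ?B \<in> w \<longleftrightarrow> subst \<theta> ?B \<in> w"
        using w by (intro subst_cong_worlds[where w = w]) (auto simp: vars_approximant)
      moreover have "subst \<theta> C = subst \<tau> (subst \<sigma> C)" for C
        by (induction C) (auto simp: \<theta>_def)
      moreover have "subst \<tau> (subst \<sigma> ?B) \<in> L"
        using unifier_approximant[OF assms(2)] subst_closed by (simp add: unifier_def S_def)
      ultimately show ?thesis
        using mem_world[OF w] by simp
    next
      case False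
      then obtain k where k: "world L k" "w \<subseteq> k" "?B \<in> k" "\<not> maximal_world L k" by blast
      have cmp: "k \<subseteq> u \<or> u \<subseteq> k" if "world L u" "w \<subseteq> u" for u
        using comparable[OF w k(1,2) that k(4)] .
      \<comment> \<open>The second conjunct adds nothing here: a type settled at \<open>k\<close> is
        settled, as the same type, at the worlds above \<open>w\<close> that lie below
        \<open>k\<close>.\<close>
      have \<epsilon>: "\<epsilon> x \<in> u \<longleftrightarrow> Imp ?B (Var x) \<in> u" if x: "x \<in> ?P" and u: "world L u" "w \<subseteq> u" for x u
      proof -
        have "\<theta> x \<in> v" if I: "Imp ?B (Var x) \<in> u" and v: "world L v" "u \<subseteq> v" "Imp ?B TT \<in> v" for v
        proof (cases "?B \<in> v")
          case True
          then have "Var x \<in> v" using world_mp[OF v(1)] I v(2) by blast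
          then have "\<epsilon> x \<in> v" using \<epsilon>_B[OF v(1) True] by blast
          then have "Imp (Imp ?B TT) (\<theta> x) \<in> v" using x v(1) by (simp add: \<epsilon>_def)
          then show ?thesis using world_mp[OF v(1,3)] by blast
        next
          case False
          then have vk: "v \<subseteq> k" using cmp[OF v(1)] u(2) v(2) k(3) by blast
          then have "TT \<in> k" "Var x \<in> k"
            using world_mp[OF k(1,3)] v(2,3) I by blast+
          then obtain t where t: "t \<in> S" "?D t \<in> k" using TT[OF k(1)] by blast
          \<comment> \<open>The double negation descends from \<open>k\<close>, because each world
            above \<open>v\<close> is comparable with \<open>k\<close> and so has a common extension
            with it.\<close>
          have "?D t \<in> v"
            unfolding world_Neg_Neg[OF v(1)]
          proof (intro allI impI)
            fix v' assume v': "world L v'" "v \<subseteq> v'"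
            have "\<exists>z. world L z \<and> v' \<subseteq> z \<and> k \<subseteq> z"
              using cmp[OF v'(1)] u(2) v(2) v' k(1) by blast
            then show "\<exists>z. world L z \<and> v' \<subseteq> z \<and> literals ?P t \<in> z"
              using t(2) unfolding world_Neg_Neg[OF k(1)] by blast
          qed
          moreover have "x \<in> t"
            using world_Neg_Neg_literals[OF k(1) finP t(2) x \<open>Var x \<in> k\<close>] .
          ultimately show ?thesis using \<theta>[OF v(1) t(1) _ x] by blast
        qed
        then have "Imp (Imp ?B TT) (\<theta> x) \<in> u" if "Imp ?B (Var x) \<in> u"
          using that by (subst world_Imp[OF u(1)]) blast
        then show ?thesis using x u(1) by (auto simp: \<epsilon>_def)
      qed
      \<comment> \<open>Prefixing \<open>?B\<close> commutes with the connectives here;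
        \<open>k\<close> is needed for \<open>Bot\<close> and \<open>Or\<close>. The case
        \<open>C = ?B\<close> gives a tautology.\<close>
      have "subst \<epsilon> C \<in> u \<longleftrightarrow> Imp ?B C \<in> u" if "vars C \<subseteq> ?P" "world L u" "w \<subseteq> u" for C u
        using that
      proof (induction C arbitrary: u)
        case (Var x)
        then show ?case using \<epsilon> by simp
      next
        case Bot
        have "Imp ?B Bot \<notin> u"
        proof -
          have "\<exists>z. world L z \<and> u \<subseteq> z \<and> ?B \<in> z"
            using cmp[OF Bot(2,3)] k Bot(2) by blast
          then show ?thesis using world_Neg[OF Bot(2)] by blast
        qed
        then show ?case using Bot(2) by simp
      next
        case (And C D)
        have "Imp ?B (And C D) \<in> u \<longleftrightarrow> Imp ?B C \<in> u \<and> Imp ?B D \<in> u"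
          using And.prems(2) by (auto simp: world_Imp)
        then show ?case using And by simp
      next
        case (Or C D)
        have "Imp ?B C \<in> u \<or> Imp ?B D \<in> u" if "Imp ?B (Or C D) \<in> u"
        proof (rule ccontr)
          assume "\<not> ?thesis"
          then obtain y z where y: "world L y" "u \<subseteq> y" "?B \<in> y" "C \<notin> y"
            and z: "world L z" "u \<subseteq> z" "?B \<in> z" "D \<notin> z"
            using world_Imp_refute[OF Or.prems(2)] by metis
          \<comment> \<open>Of two comparable worlds the smaller refutes both disjuncts.
            Incomparable ones are maximal, and then \<open>k\<close> lies below both and refutes
            both disjuncts.\<close>
          have "\<exists>v. world L v \<and> u \<subseteq> v \<and> ?B \<in> v \<and> C \<notin> v \<and> D \<notin> v"
          proof (cases "y \<subseteq> z \<or> z \<subseteq> y")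
            case True
            then show ?thesis using y z by blast
          next
            case False
            then have mx: "maximal_world L y" "maximal_world L z"
              using comparable[OF Or.prems(2) y(1,2) z(1,2)] comparable[OF Or.prems(2) z(1,2) y(1,2)] by blast+
            have "k \<subseteq> y"
              using cmp[OF y(1) subset_trans[OF Or.prems(3) y(2)]] mx(1) k(1)
              by (auto simp: maximal_world_def)
            moreover have "k \<subseteq> z"
              using cmp[OF z(1) subset_trans[OF Or.prems(3) z(2)]] mx(2) k(1)
              by (auto simp: maximal_world_def)
            moreover have "u \<subseteq> k"
            proof -
              have "?B \<notin> u"
                using world_mp[OF Or.prems(2) _ that] world_Or[OF Or.prems(2)] y(2,4) z(2,4) by blast
              then show ?thesis
                using cmp[OF Or.prems(2,3)] k(3) by blast
            qed
            ultimately show ?thesis using k y(4) z(4) by blast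
          qed
          then show False
            using that world_mp world_Or by blast
        qed
        moreover have "Imp ?B (Or C D) \<in> u" if "Imp ?B C \<in> u \<or> Imp ?B D \<in> u"
          using that Or.prems(2) by (auto simp: world_Imp)
        ultimately show ?case using Or by auto
      next
        case (Imp C D)
        have IH: "subst \<epsilon> C \<in> v \<longleftrightarrow> Imp ?B C \<in> v" "subst \<epsilon> D \<in> v \<longleftrightarrow> Imp ?B D \<in> v"
          if "world L v" "u \<subseteq> v" for v
          using Imp.IH(1)[OF _ that(1)] Imp.IH(2)[OF _ that(1)] Imp.prems that(2) by auto
        have "subst \<epsilon> (Imp C D) \<in> u \<longleftrightarrow> (\<forall>v. world L v \<longrightarrow> u \<subseteq> v \<longrightarrow> Imp ?B C \<in> v \<longrightarrow> Imp ?B D \<in> v)"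
          using Imp.prems(2) IH by (simp add: world_Imp[of u] cong: imp_cong)
        also have "\<dots> \<longleftrightarrow> Imp ?B (Imp C D) \<in> u"
        proof
          assume *: "\<forall>v. world L v \<longrightarrow> u \<subseteq> v \<longrightarrow> Imp ?B C \<in> v \<longrightarrow> Imp ?B D \<in> v"
          have "D \<in> v" if v: "world L v" "u \<subseteq> v" "?B \<in> v" "C \<in> v" for v
          proof -
            have "Imp ?B C \<in> v" using v(1,4) by (auto simp: world_Imp)
            then have "Imp ?B D \<in> v" using * v(1,2) by blast
            then show ?thesis using world_mp[OF v(1,3)] by blast
          qed
          then have "Imp C D \<in> v" if "world L v" "u \<subseteq> v" "?B \<in> v" for v
            by (subst world_Imp[OF that(1)]) (use that in blast)
          then show "Imp ?B (Imp C D) \<in> u"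
            by (subst world_Imp[OF Imp.prems(2)]) blast
        next
          assume I: "Imp ?B (Imp C D) \<in> u"
          show "\<forall>v. world L v \<longrightarrow> u \<subseteq> v \<longrightarrow> Imp ?B C \<in> v \<longrightarrow> Imp ?B D \<in> v"
          proof (intro allI impI)
            fix v assume v: "world L v" "u \<subseteq> v" "Imp ?B C \<in> v"
            have "D \<in> z" if z: "world L z" "v \<subseteq> z" "?B \<in> z" for z
            proof -
              have "C \<in> z" using world_mp[OF z(1,3)] v(3) z(2) by blast
              moreover have "Imp C D \<in> z" using world_mp[OF z(1,3)] I v(2) z(2) by blast
              ultimately show ?thesis using world_mp[OF z(1)] by blast
            qed
            then show "Imp ?B D \<in> v" by (subst world_Imp[OF v(1)]) blast
          qed
        qed
        finally show ?case .
      qed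
      moreover have "Imp ?B ?B \<in> w" using w by (simp add: world_Imp)
      ultimately show ?thesis using w by (simp add: vars_approximant)
    qed
  qed
  ultimately show ?thesis
    by (auto simp: projective_unifier_def unifier_def)
qed

lemma projective_approximation: "projective_approximation L"
  unfolding projective_approximation_def
proof
  fix A
  \<comment> \<open>Unifiers may be infinite in number, but only their sets of types enter.\<close>
  let ?\<Pi> = "(\<lambda>\<sigma>. approximant A (unified_types L (vars A) \<sigma>)) ` {\<sigma>. unifier L \<sigma> A}"
  have "?\<Pi> \<subseteq> approximant A ` Pow (Pow (vars A))"
    by (auto simp: unified_types_def)
  then have "finite ?\<Pi>"
    using finite_vars[of A] by (meson finite_Pow_iff finite_imageI finite_subset)
  then show "\<exists>\<Pi>. finite \<Pi> \<and>
        (\<forall>B\<in>\<Pi>. (\<exists>\<epsilon>. projective_unifier L \<epsilon> B) \<and> vars B \<subseteq> vars A \<and> derives L {B} A) \<and>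
        (\<forall>\<epsilon>. unifier L \<epsilon> A \<longrightarrow> (\<exists>B\<in>\<Pi>. unifier L \<epsilon> B))"
    using projective_approximant derives_approximant unifier_approximant
    by (intro exI[of _ ?\<Pi>]) (auto simp: vars_approximant)
qed

end


section \<open>The equivalence\<close>

theorem theorem5p14:
  fixes L :: "fm set"
  assumes "intermediate_logic L"
  shows "(hereditary_projective_approximation L \<longleftrightarrow> logic_of H_pa \<subseteq> L) \<and>
         (logic_of H_pa \<subseteq> L \<longleftrightarrow> omits L G3 \<and> omits L R2) \<and>
         (omits L G3 \<and> omits L R2 \<longleftrightarrow> jankov G3 \<in> L \<and> jankov R2 \<in> L)"
proof -
  interpret intermediate L by standard (rule assms)
  let ?fork = "\<forall>p q s. fork_axiom p q s \<in> L"
  \<comment> \<open>If a frame were not omitted, its own logic would be an extension of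
    \<open>L\<close> without projective approximation.\<close>
  have "omits L G3 \<and> omits L R2" if "hereditary_projective_approximation L"
    using that no_projective_approximation_G3 no_projective_approximation_R2
      intermediate_logic_of_frame[OF is_frame_G3] intermediate_logic_of_frame[OF is_frame_R2]
    unfolding hereditary_projective_approximation_def omits_def by blast
  moreover have "?fork" if "omits L G3 \<and> omits L R2"
    using that omits_fork_axiom by blast
  moreover have "omits L G3 \<and> omits L R2" if ?fork
    using that fork_axiom_not_in_G3 fork_axiom_not_in_R2 unfolding omits_def by blast
  moreover have "logic_of H_pa \<subseteq> L" if ?fork
  proof -
    interpret fork_logic L by standard (use that in blast)
    show ?thesis by (rule logic_of_H_pa_subset)
  qed
  moreover have ?fork if "logic_of H_pa \<subseteq> L"
    using that fork_axiom_in_logic_of_H_pa by blast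
  moreover have "hereditary_projective_approximation L" if ?fork
    unfolding hereditary_projective_approximation_def
  proof (intro allI impI)
    fix L' assume "intermediate_logic L'" "L \<subseteq> L'"
    \<comment> \<open>Axioms pass to extensions, which is why the approximation property is
      hereditary.\<close>
    then interpret L': fork_logic L' by unfold_locales (use that in blast)+
    show "projective_approximation L'" by (rule L'.projective_approximation)
  qed
  ultimately show ?thesis
    unfolding jankov_iff_omits[OF is_frame_G3] jankov_iff_omits[OF is_frame_R2] by blast
qed

end
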